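(* Let $f,h^x,h^\theta,g,\mathcal P,f^\star$ be the data of the robust perception POP described in the context (for any one of its four instances), with $f=\sum_{\alpha\in\mathcal F}c(\alpha)p^\alpha$. Consider the sparse moment relaxation $$p^\star_{\mathcal B}=\min_{z_{2\mathcal B}\in\mathbb R^{m(2\mathcal B)}}\ \sum_{\alpha\in\mathcal F}c(\alpha)z_\alpha$$ subject to $$z_{0}=1,\quad M_{\mathcal B}(z_{2\mathcal B})\succeq0,\quad M_1(h z_2)=0\ \ \forall h\in h^x,\quad M_{\mathcal B_x}(h z_{2\mathcal B_x})=0\ \ \forall h\in h^\theta,\quad M_1(g_k z_2)\succeq0\ \ \forall g_k\in g .$$ Then $p^\star_{\mathcal B}\le p^\star_2\le f^\star$, where $p_2^\star$ is the optimal value of the dense moment relaxation of order 2. Moreover, letting $z^\star_{2\mathcal B}$ be the optimal solution of the sparse relaxation: (a) (optimality certificate) if $\operatorname{rank}M_{\mathcal B}(z^\star_{2\mathcal B})=1$, then $z^\star_{\mathcal B}=[p^\star]_{\mathcal B}$, where $p^\star$ is the unique global minimizer of the POP (the relaxation is then said to be tight); (b) (rounding and duality gap) if $\operatorname{rank}M_{\mathcal B}(z^\star_{2\mathcal B})>1$, let $\hat p\in\mathcal P$ be a rounded estimate computed from a rank-1 approximation of $M_{\mathcal B}(z^\star_{2\mathcal B})$ and $\hat f=f(\hat p)$; then $p^\star_{\mathcal B}\le f^\star\le\hat f$ (and $(\hat f-p^\star_{\mathcal B})/\hat f$ is called the relative duality gap).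
   Context: Robust perception POP. $N\ge1$, $\bar c>0$, $\beta_i>0$ are given; $p=[x^{\mathsf T},\theta^{\mathsf T}]^{\mathsf T}\in\mathbb R^{\tilde n}$, $\tilde n=n+N$, $x\in\mathbb R^n$, $\theta\in\mathbb R^N$. The POP is $f^\star=\min_p f(p)$ subject to $h(p)=0$ for all $h\in h^x\cup h^\theta$ and $1\ge g_k(p)\ge0$ for all $g_k\in g$; its feasible set is $\mathcal P$. Here $$f(p)=\sum_{i=1}^N\Big(\frac{1+\theta_i}{2\beta_i^2}\rho_i(x)+\frac{1-\theta_i}{2}\bar c^2\Big),\qquad h^\theta=\{1-\theta_i^2\}_{i=1}^N,$$ and $(\rho_i,h^x,g)$ is one of the following. For a $3\times3$ matrix $R$ with columns $r_1,r_2,r_3$, let $h^r(R)$ be the 15 polynomials $1-\|r_1\|^2,1-\|r_2\|^2,1-\|r_3\|^2,r_1^{\mathsf T}r_2,r_2^{\mathsf T}r_3,r_3^{\mathsf T}r_1$ and the entries of $r_1\times r_2-r_3$, $r_2\times r_3-r_1$, $r_3\times r_1-r_2$ (they define $R\in\mathrm{SO}(3)$). - Single rotation averaging: $n=9$, $x=\mathrm{vec}(R)$, data $R_i\in\mathrm{SO}(3)$; $\rho_i=6-2\,\mathrm{vec}(R_i)^{\mathsf T}x$, $h^x=h^r(R)$, $g=\emptyset$. - Shape alignment: $n=6$, $x=[\bar r_1^{\mathsf T},\bar r_2^{\mathsf T}]^{\mathsf T}$ with $\bar r_1,\bar r_2\in\mathbb R^3$ the rows of $\bar R\in\mathbb R^{2\times3}$,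 data $B_i\in\mathbb R^3,b_i\in\mathbb R^2$, $\bar s>0$; $\rho_i=\|b_i-\bar RB_i\|^2$, $h^x=\{\|\bar r_1\|^2-\|\bar r_2\|^2,\ \bar r_1^{\mathsf T}\bar r_2\}$, $g=\{1-(\|\bar r_1\|^2+\|\bar r_2\|^2)/(2\bar s^2)\}$. - Point cloud registration: $n=12$, $x=[\mathrm{vec}(R)^{\mathsf T},t^{\mathsf T}]^{\mathsf T}$, data $a_i,b_i\in\mathbb R^3$, $T>0$; $\rho_i=\|t\|^2-2b_i^{\mathsf T}t-2b_i^{\mathsf T}Ra_i+2t^{\mathsf T}Ra_i+\|a_i\|^2+\|b_i\|^2$, $h^x=h^r(R)$, $g=\{1-\|t\|^2/T^2\}$. - Mesh registration: $n=12$, $x=[\mathrm{vec}(\tilde R)^{\mathsf T},\tilde t^{\mathsf T}]^{\mathsf T}$, data $a_i,b_i\in\mathbb R^3$, unit vectors $u_i,v_i\in\mathbb R^3$, $w_i>0$, $T>0$; $\rho_i=(u_i^{\mathsf T}\tilde Rb_i-u_i^{\mathsf T}a_i-u_i^{\mathsf T}\tilde t)^2+w_i(\|v_i\|^2+\|u_i\|^2-2u_i^{\mathsf T}\tilde Rv_i)$, $h^x=h^r(\tilde R)$, $g=\{1-\|\tilde t\|^2/T^2\}$. Monomials. $[p]_d$ is the vector of all monomials in $p$ of degree at most $d$. $[p]_{\mathcal B}=[1,x^{\mathsf T},\theta^{\mathsf T},(x)_2^{\mathsf T},\theta^{\mathsf T}\otimes x^{\mathsf T}]^{\mathsf T}$,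 where $(x)_2$ is the vector of monomials in $x$ of degree exactly 2; $\mathcal B\subset\mathbb Z_+^{\tilde n}$ is its set of exponents. $[p]_{\mathcal B_x}=[1,x^{\mathsf T}]^{\mathsf T}$ with exponent set $\mathcal B_x$. $2\mathcal B=\{\alpha_1+\alpha_2:\alpha_1,\alpha_2\in\mathcal B\}$, similarly $2\mathcal B_x$; $m(\cdot)$ is the cardinality of an exponent set. Moments. $z_{2\mathcal B}=(z_\alpha)_{\alpha\in2\mathcal B}$ is a real vector and $z_{\mathcal B}=(z_\alpha)_{\alpha\in\mathcal B}$ its subvector. $L_z$ is the linear map sending a polynomial $\sum_\alpha c_\alpha p^\alpha$ to $\sum_\alpha c_\alpha z_\alpha$, applied entrywise to matrices. $M_{\mathcal B}(z_{2\mathcal B})=L_z([p]_{\mathcal B}[p]_{\mathcal B}^{\mathsf T})$, $M_1(q z_2)=L_z(q\,[p]_1[p]_1^{\mathsf T})$, $M_{\mathcal B_x}(q z_{2\mathcal B_x})=L_z(q\,[p]_{\mathcal B_x}[p]_{\mathcal B_x}^{\mathsf T})$ for a polynomial $q$ (all moments appearing have exponents in $2\mathcal B$). Dense relaxation of order 2: $p_2^\star$ is the minimum of $\sum_\alpha c(\alpha)z_\alpha$ over real vectors $(z_\alpha)$ indexed by all exponents of degree at most 4, subject to $z_0=1$, $L_z([p]_2[p]_2^{\mathsf T})\succeq0$, $L_z(h[p]_1[p]_1^{\mathsf T})=0$ for all $h\in h^x\cup h^\theta$, $L_z(g_k[p]_1[p]_1^{\mathsf T})\succeq0$ for all $g_k\in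 g$. Rounding: take an eigenvector of $M_{\mathcal B}(z^\star_{2\mathcal B})$ for its largest eigenvalue, scale it so that its entry indexed by the monomial $1$ equals 1, extract the subvector of entries indexed by the monomials in $p$ (the degree-one monomials $x$ and $\theta$), and project it onto $\mathcal P$; the result is $\hat p\in\mathcal P$.
   Formalization: In (a), uniqueness of the global minimizer is stated when z* is the only optimal solution of the sparse relaxation; for an arbitrary rank-one optimal solution it can fail (shape alignment with all B_i=0, b_i=0), and then only z*_B=[p*]_B for some global minimizer p* is stated. *)

theory Defs
  imports
    Complex_Main
    "HOL-Library.FuncSet"
    "HOL-Library.Poly_Mapping"
    "Jordan_Normal_Form.Matrix"
    "Jordan_Normal_Form.Determinant"
    "Jordan_Normal_Form.Char_Poly"
    "Jordan_Normal_Form.DL_Rank"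
begin

section \<open>Polynomials in finitely many real variables\<close>

type_synonym expo = "nat \<Rightarrow>\<^sub>0 nat"
type_synonym rpoly = "expo \<Rightarrow>\<^sub>0 real"

definition pconst :: "real \<Rightarrow> rpoly" where
  "pconst c = Poly_Mapping.single 0 c"

definition evar :: "nat \<Rightarrow> expo" where
  "evar i = Poly_Mapping.single i 1"

definition pmonom :: "expo \<Rightarrow> rpoly" where
  "pmonom \<alpha> = Poly_Mapping.single \<alpha> 1"

definition pvar :: "nat \<Rightarrow> rpoly" where
  "pvar i = pmonom (evar i)"

definition expo_eval :: "real vec \<Rightarrow> expo \<Rightarrow> real" where
  "expo_eval p \<alpha> = (\<Prod>i\<in>Poly_Mapping.keys \<alpha>. (p $ i) ^ Poly_Mapping.lookup \<alpha> i)"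

definition peval :: "rpoly \<Rightarrow> real vec \<Rightarrow> real" where
  "peval q p = (\<Sum>\<alpha>\<in>Poly_Mapping.keys q. Poly_Mapping.lookup q \<alpha> * expo_eval p \<alpha>)"

definition total_degree :: "expo \<Rightarrow> nat" where
  "total_degree \<alpha> = (\<Sum>i\<in>Poly_Mapping.keys \<alpha>. Poly_Mapping.lookup \<alpha> i)"

definition expos_upto :: "nat \<Rightarrow> nat \<Rightarrow> expo set" where
  "expos_upto m d = {\<alpha>. Poly_Mapping.keys \<alpha> \<subseteq> {..<m} \<and> total_degree \<alpha> \<le> d}"

lemma finite_expos_upto: "finite (expos_upto m d)"
proof -
  let ?F = "{f. \<forall>i. (i \<in> {..<m} \<longrightarrow> f i \<in> {..d}) \<and> (i \<notin> {..<m} \<longrightarrow> f i = (0::nat))}"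
  have "Poly_Mapping.lookup \<alpha> \<in> ?F" if "\<alpha> \<in> expos_upto m d" for \<alpha>
  proof -
    have "Poly_Mapping.lookup \<alpha> i \<le> d" if "i \<in> Poly_Mapping.keys \<alpha>" for i
    proof -
      have "Poly_Mapping.lookup \<alpha> i \<le> total_degree \<alpha>"
        unfolding total_degree_def by (rule member_le_sum) (use that in auto)
      then show ?thesis
        using \<open>\<alpha> \<in> expos_upto m d\<close> by (simp add: expos_upto_def)
    qed
    moreover have "Poly_Mapping.lookup \<alpha> i = 0" if "i \<notin> Poly_Mapping.keys \<alpha>" for i
      using that by (simp add: in_keys_iff)
    ultimately show ?thesis
      using that by (auto simp: expos_upto_def) (metis zero_le)
  qed
  then have "Poly_Mapping.lookup ` expos_upto m d \<subseteq> ?F" by (rule image_subsetI)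
  moreover have "finite ?F" by (rule finite_set_of_finite_funs) auto
  ultimately have "finite (Poly_Mapping.lookup ` expos_upto m d)" by (rule finite_subset)
  then show ?thesis
    by (rule finite_imageD) (simp add: inj_on_def)
qed

section \<open>Moment matrices\<close>

text \<open>A vector of monomials is a list of exponents.  A vector of moments indexed by a finite set
  \<open>I\<close> of exponents is an element of \<open>extensional I\<close>, so that equality of functions is equality
  of vectors; no constraint or objective below refers to a moment outside the respective \<open>I\<close>.\<close>

definition mons_upto :: "nat \<Rightarrow> nat \<Rightarrow> expo list" where
  "mons_upto m d = sorted_list_of_set (expos_upto m d)"

definition mons_Bx :: "nat \<Rightarrow> expo list" where
  "mons_Bx n = 0 # map evar [0..<n]"

text \<open>The variables \<open>0, \<dots>, n - 1\<close> are \<open>x\<close> and \<open>n, \<dots>, n + N - 1\<close> are \<open>\<theta>\<close>; the five blocks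
  are \<open>1\<close>, \<open>x\<close>, \<open>\<theta>\<close>, \<open>(x)\<^sub>2\<close> and \<open>\<theta> \<otimes> x\<close>.\<close>

definition mons_B :: "nat \<Rightarrow> nat \<Rightarrow> expo list" where
  "mons_B n N =
     [0]
     @ map evar [0..<n]
     @ map evar [n..<n + N]
     @ [evar i + evar j. i \<leftarrow> [0..<n], j \<leftarrow> [i..<n]]
     @ [evar (n + i) + evar j. i \<leftarrow> [0..<N], j \<leftarrow> [0..<n]]"

definition expo_double :: "expo list \<Rightarrow> expo set" where
  "expo_double S = {\<alpha> + \<beta> | \<alpha> \<beta>. \<alpha> \<in> set S \<and> \<beta> \<in> set S}"

definition mon_vec :: "expo list \<Rightarrow> real vec \<Rightarrow> real vec" where
  "mon_vec S p = vec_of_list (map (expo_eval p) S)"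

definition moment_subvec :: "expo list \<Rightarrow> (expo \<Rightarrow> real) \<Rightarrow> real vec" where
  "moment_subvec S z = vec_of_list (map z S)"

definition moment_functional :: "(expo \<Rightarrow> real) \<Rightarrow> rpoly \<Rightarrow> real" where
  "moment_functional z q = (\<Sum>\<alpha>\<in>Poly_Mapping.keys q. Poly_Mapping.lookup q \<alpha> * z \<alpha>)"

text \<open>The functional applied entrywise to \<open>q [p]\<^sub>S [p]\<^sub>S\<^sup>T\<close>.\<close>

definition localizing_mat :: "expo list \<Rightarrow> rpoly \<Rightarrow> (expo \<Rightarrow> real) \<Rightarrow> real mat" where
  "localizing_mat S q z =
     mat (length S) (length S)
       (\<lambda>(i, j). moment_functional z (q * (pmonom (S ! i) * pmonom (S ! j))))"

abbreviation moment_mat :: "expo list \<Rightarrow> (expo \<Rightarrow> real) \<Rightarrow> real mat" where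
  "moment_mat S z \<equiv> localizing_mat S 1 z"

definition psd_mat :: "real mat \<Rightarrow> bool" where
  "psd_mat A \<longleftrightarrow>
     A \<in> carrier_mat (dim_row A) (dim_row A) \<and> transpose_mat A = A \<and>
     (\<forall>v \<in> carrier_vec (dim_row A). 0 \<le> v \<bullet> (A *\<^sub>v v))"

definition mat_rank :: "real mat \<Rightarrow> nat" where
  "mat_rank A = vec_space.rank (dim_row A) A"

section \<open>The four robust perception problems\<close>

text \<open>The data attached to the \<open>i\<close>-th measurement, \<open>i < N\<close>, are the values at \<open>i\<close> of the
  functions below.\<close>

datatype problem =
    Single_Rotation_Averaging (* R *) "nat \<Rightarrow> real mat"
  | Shape_Alignment (* B, b, s *) "nat \<Rightarrow> real vec" "nat \<Rightarrow> real vec" real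
  | Point_Cloud_Registration (* a, b, T *) "nat \<Rightarrow> real vec" "nat \<Rightarrow> real vec" real
  | Mesh_Registration (* a, b, u, v, w, T *)
      "nat \<Rightarrow> real vec" "nat \<Rightarrow> real vec" "nat \<Rightarrow> real vec" "nat \<Rightarrow> real vec" "nat \<Rightarrow> real" real

definition SO3 :: "real mat set" where
  "SO3 = {A \<in> carrier_mat 3 3. transpose_mat A * A = 1\<^sub>m 3 \<and> det A = 1}"

fun admissible_data :: "nat \<Rightarrow> problem \<Rightarrow> bool" where
  "admissible_data N (Single_Rotation_Averaging R) \<longleftrightarrow> (\<forall>i<N. R i \<in> SO3)"
| "admissible_data N (Shape_Alignment B b s) \<longleftrightarrow>
     (\<forall>i<N. B i \<in> carrier_vec 3 \<and> b i \<in> carrier_vec 2) \<and> s > 0"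
| "admissible_data N (Point_Cloud_Registration a b T) \<longleftrightarrow>
     (\<forall>i<N. a i \<in> carrier_vec 3 \<and> b i \<in> carrier_vec 3) \<and> T > 0"
| "admissible_data N (Mesh_Registration a b u v w T) \<longleftrightarrow>
     (\<forall>i<N. a i \<in> carrier_vec 3 \<and> b i \<in> carrier_vec 3 \<and>
        u i \<in> carrier_vec 3 \<and> u i \<bullet> u i = 1 \<and> v i \<in> carrier_vec 3 \<and> v i \<bullet> v i = 1 \<and> w i > 0) \<and>
     T > 0"

fun xdim :: "problem \<Rightarrow> nat" where
  "xdim (Single_Rotation_Averaging R) = 9"
| "xdim (Shape_Alignment B b s) = 6"
| "xdim (Point_Cloud_Registration a b T) = 12"
| "xdim (Mesh_Registration a b u v w T) = 12"

text \<open>\<open>vec(\<cdot>)\<close> stacks columns.\<close>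

definition vectorize :: "'a mat \<Rightarrow> 'a vec" where
  "vectorize A = vec (dim_row A * dim_col A) (\<lambda>k. A $$ (k mod dim_row A, k div dim_row A))"

definition xvec :: "nat \<Rightarrow> rpoly vec" where
  "xvec n = vec n pvar"

definition rot :: "rpoly mat" where
  "rot = mat 3 3 (\<lambda>(i, j). pvar (3 * j + i))"

definition transl :: "rpoly vec" where
  "transl = vec 3 (\<lambda>i. pvar (9 + i))"

definition affine_rot :: "rpoly mat" where
  "affine_rot = mat 2 3 (\<lambda>(i, j). pvar (3 * i + j))"

lemma vectorize_rot: "vectorize rot = xvec 9"
  by (rule eq_vecI) (auto simp: vectorize_def rot_def xvec_def)

abbreviation cvec :: "real vec \<Rightarrow> rpoly vec" where
  "cvec \<equiv> map_vec pconst"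

definition cross_vec :: "'a::comm_ring_1 vec \<Rightarrow> 'a vec \<Rightarrow> 'a vec" where
  "cross_vec a b = vec_of_list
     [a $ 1 * b $ 2 - a $ 2 * b $ 1, a $ 2 * b $ 0 - a $ 0 * b $ 2, a $ 0 * b $ 1 - a $ 1 * b $ 0]"

definition h_rot :: "rpoly mat \<Rightarrow> rpoly set" where
  "h_rot R =
     (let r1 = col R 0; r2 = col R 1; r3 = col R 2 in
      {1 - r1 \<bullet> r1, 1 - r2 \<bullet> r2, 1 - r3 \<bullet> r3, r1 \<bullet> r2, r2 \<bullet> r3, r3 \<bullet> r1}
      \<union> {(cross_vec r1 r2 - r3) $ k | k. k < 3}
      \<union> {(cross_vec r2 r3 - r1) $ k | k. k < 3}
      \<union> {(cross_vec r3 r1 - r2) $ k | k. k < 3})"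

fun residual :: "problem \<Rightarrow> nat \<Rightarrow> rpoly" where
  "residual (Single_Rotation_Averaging R) i = 6 - 2 * (cvec (vectorize (R i)) \<bullet> xvec 9)"
| "residual (Shape_Alignment B b s) i =
     (let e = cvec (b i) - affine_rot *\<^sub>v cvec (B i) in e \<bullet> e)"
| "residual (Point_Cloud_Registration a b T) i =
     (let a' = cvec (a i); b' = cvec (b i) in
      transl \<bullet> transl - 2 * (b' \<bullet> transl) - 2 * (b' \<bullet> (rot *\<^sub>v a'))
      + 2 * (transl \<bullet> (rot *\<^sub>v a')) + a' \<bullet> a' + b' \<bullet> b')"
| "residual (Mesh_Registration a b u v w T) i =
     (let a' = cvec (a i); b' = cvec (b i); u' = cvec (u i); v' = cvec (v i) in
      (u' \<bullet> (rot *\<^sub>v b') - u' \<bullet> a' - u' \<bullet> transl)\<^sup>2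
      + pconst (w i) * (v' \<bullet> v' + u' \<bullet> u' - 2 * (u' \<bullet> (rot *\<^sub>v v'))))"

fun h_x :: "problem \<Rightarrow> rpoly set" where
  "h_x (Single_Rotation_Averaging R) = h_rot rot"
| "h_x (Shape_Alignment B b s) =
     (let r1 = row affine_rot 0; r2 = row affine_rot 1 in {r1 \<bullet> r1 - r2 \<bullet> r2, r1 \<bullet> r2})"
| "h_x (Point_Cloud_Registration a b T) = h_rot rot"
| "h_x (Mesh_Registration a b u v w T) = h_rot rot"

fun g_ineq :: "problem \<Rightarrow> rpoly set" where
  "g_ineq (Single_Rotation_Averaging R) = {}"
| "g_ineq (Shape_Alignment B b s) =
     (let r1 = row affine_rot 0; r2 = row affine_rot 1
      in {1 - pconst (1 / (2 * s\<^sup>2)) * (r1 \<bullet> r1 + r2 \<bullet> r2)})"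
| "g_ineq (Point_Cloud_Registration a b T) = {1 - pconst (1 / T\<^sup>2) * (transl \<bullet> transl)}"
| "g_ineq (Mesh_Registration a b u v w T) = {1 - pconst (1 / T\<^sup>2) * (transl \<bullet> transl)}"

definition theta :: "problem \<Rightarrow> nat \<Rightarrow> rpoly" where
  "theta P i = pvar (xdim P + i)"

definition h_theta :: "nat \<Rightarrow> problem \<Rightarrow> rpoly set" where
  "h_theta N P = {1 - (theta P i)\<^sup>2 | i. i < N}"

definition objective :: "nat \<Rightarrow> (nat \<Rightarrow> real) \<Rightarrow> real \<Rightarrow> problem \<Rightarrow> rpoly" where
  "objective N \<beta> c P =
     (\<Sum>i<N. pconst (1 / (2 * (\<beta> i)\<^sup>2)) * (1 + theta P i) * residual P i
            + pconst (c\<^sup>2 / 2) * (1 - theta P i))"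

section \<open>The polynomial optimization problem and its relaxations\<close>

definition pop_feasible :: "nat \<Rightarrow> problem \<Rightarrow> real vec set" where
  "pop_feasible N P = {p \<in> carrier_vec (xdim P + N).
     (\<forall>h \<in> h_x P \<union> h_theta N P. peval h p = 0) \<and>
     (\<forall>g \<in> g_ineq P. 0 \<le> peval g p \<and> peval g p \<le> 1)}"

definition pop_minimizer :: "nat \<Rightarrow> (nat \<Rightarrow> real) \<Rightarrow> real \<Rightarrow> problem \<Rightarrow> real vec \<Rightarrow> bool" where
  "pop_minimizer N \<beta> c P =
     is_arg_min (peval (objective N \<beta> c P)) (\<lambda>p. p \<in> pop_feasible N P)"

definition pop_value :: "nat \<Rightarrow> (nat \<Rightarrow> real) \<Rightarrow> real \<Rightarrow> problem \<Rightarrow> real" where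
  "pop_value N \<beta> c P = (INF p \<in> pop_feasible N P. peval (objective N \<beta> c P) p)"

definition sparse_feasible :: "nat \<Rightarrow> problem \<Rightarrow> (expo \<Rightarrow> real) set" where
  "sparse_feasible N P =
     (let n = xdim P; m = n + N; B = mons_B n N; M1 = mons_upto m 1 in
      {z \<in> extensional (expo_double B).
        z 0 = 1 \<and>
        psd_mat (moment_mat B z) \<and>
        (\<forall>h \<in> h_x P. localizing_mat M1 h z = 0\<^sub>m (length M1) (length M1)) \<and>
        (\<forall>h \<in> h_theta N P.
           localizing_mat (mons_Bx n) h z = 0\<^sub>m (length (mons_Bx n)) (length (mons_Bx n))) \<and>
        (\<forall>g \<in> g_ineq P. psd_mat (localizing_mat M1 g z))})"

definition sparse_optimal ::
  "nat \<Rightarrow> (nat \<Rightarrow> real) \<Rightarrow> real \<Rightarrow> problem \<Rightarrow> (expo \<Rightarrow> real) \<Rightarrow> bool" where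
  "sparse_optimal N \<beta> c P =
     is_arg_min (\<lambda>z. moment_functional z (objective N \<beta> c P)) (\<lambda>z. z \<in> sparse_feasible N P)"

definition sparse_value :: "nat \<Rightarrow> (nat \<Rightarrow> real) \<Rightarrow> real \<Rightarrow> problem \<Rightarrow> real" where
  "sparse_value N \<beta> c P =
     (INF z \<in> sparse_feasible N P. moment_functional z (objective N \<beta> c P))"

definition dense_feasible :: "nat \<Rightarrow> problem \<Rightarrow> (expo \<Rightarrow> real) set" where
  "dense_feasible N P =
     (let m = xdim P + N; M1 = mons_upto m 1; M2 = mons_upto m 2 in
      {z \<in> extensional (expos_upto m 4).
        z 0 = 1 \<and>
        psd_mat (moment_mat M2 z) \<and>
        (\<forall>h \<in> h_x P \<union> h_theta N P. localizing_mat M1 h z = 0\<^sub>m (length M1) (length M1)) \<and>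
        (\<forall>g \<in> g_ineq P. psd_mat (localizing_mat M1 g z))})"

definition dense_optimal ::
  "nat \<Rightarrow> (nat \<Rightarrow> real) \<Rightarrow> real \<Rightarrow> problem \<Rightarrow> (expo \<Rightarrow> real) \<Rightarrow> bool" where
  "dense_optimal N \<beta> c P =
     is_arg_min (\<lambda>z. moment_functional z (objective N \<beta> c P)) (\<lambda>z. z \<in> dense_feasible N P)"

definition dense_value :: "nat \<Rightarrow> (nat \<Rightarrow> real) \<Rightarrow> real \<Rightarrow> problem \<Rightarrow> real" where
  "dense_value N \<beta> c P =
     (INF z \<in> dense_feasible N P. moment_functional z (objective N \<beta> c P))"

abbreviation sparse_moment_mat :: "nat \<Rightarrow> problem \<Rightarrow> (expo \<Rightarrow> real) \<Rightarrow> real mat" where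
  "sparse_moment_mat N P z \<equiv> moment_mat (mons_B (xdim P) N) z"

section \<open>Rounding\<close>

definition leading_eigenvector :: "real mat \<Rightarrow> real vec \<Rightarrow> bool" where
  "leading_eigenvector A v \<longleftrightarrow>
     (\<exists>k. eigenvector A v k \<and> (\<forall>k'. eigenvalue A k' \<longrightarrow> k' \<le> k))"

text \<open>A relation, because neither the eigenvector nor the nearest feasible point need be unique.
  In \<^const>\<open>mons_B\<close> the monomial \<open>1\<close> has position \<open>0\<close> and variable \<open>i\<close> has position \<open>Suc i\<close>.\<close>

definition rounded_estimate :: "nat \<Rightarrow> problem \<Rightarrow> (expo \<Rightarrow> real) \<Rightarrow> real vec \<Rightarrow> bool" where
  "rounded_estimate N P z p \<longleftrightarrow>
     (\<exists>v. leading_eigenvector (sparse_moment_mat N P z) v \<and> v $ 0 \<noteq> 0 \<and>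
        (let w = (1 / v $ 0) \<cdot>\<^sub>v v;
             y = vec (xdim P + N) (\<lambda>i. w $ Suc i)
         in is_arg_min (\<lambda>q. sqrt ((q - y) \<bullet> (q - y))) (\<lambda>q. q \<in> pop_feasible N P) p))"

end

theory Submission
  imports Defs "HOL-Analysis.Function_Topology"
begin

text \<open>The key combinatorial fact is that \<open>\<B>\<close> consists of the sums of an exponent of \<open>[1, x]\<close> and
  an exponent of \<open>[1, p]\<close>.  Hence the product of a quadratic polynomial in \<open>x\<close> and two affine
  polynomials in \<open>p\<close> has its exponents in \<open>2\<B>\<close>, so that every moment occurring in the sparse relaxation
  is an entry of the moment matrix.  A feasible point yields a dense feasible vector by evaluating monomials,
  and a dense feasible vector restricts to a sparse one, which gives the two inequalities.

  The constraints bound the sum of squares of \<open>x\<close> by a constant and force \<open>\<theta>\<^sub>i\<^sup>2 = 1\<close>; localized,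
  they bound the diagonal of the moment matrix and therefore, by positive semidefiniteness, all
  moments.  All three feasible sets are thus compact, and the minima are attained.

  If the moment matrix has rank one, then \<open>z\<^bsub>\<alpha> + \<gamma>\<^esub> = z\<^bsub>\<alpha>\<^esub> z\<^bsub>\<gamma>\<^esub>\<close> on \<open>\<B>\<close>, because
  \<open>z\<^bsub>0\<^esub> = 1\<close>, so \<open>z\<close> evaluates monomials at the point formed by the
  degree-one moments.  That point is feasible and attains the lower bound.\<close>

section \<open>Evaluation of polynomials and linear functionals\<close>

lemma moment_functional_superset:
  assumes "finite S" "Poly_Mapping.keys q \<subseteq> S"
  shows "moment_functional z q = (\<Sum>\<alpha>\<in>S. Poly_Mapping.lookup q \<alpha> * z \<alpha>)"
  unfolding moment_functional_def
  by (rule sum.mono_neutral_left) (use assms in \<open>auto simp: in_keys_iff\<close>)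

lemma moment_functional_add:
  "moment_functional z (q + r) = moment_functional z q + moment_functional z r"
proof -
  let ?S = "Poly_Mapping.keys q \<union> Poly_Mapping.keys r"
  have "moment_functional z s = (\<Sum>\<alpha>\<in>?S. Poly_Mapping.lookup s \<alpha> * z \<alpha>)"
    if "s \<in> {q, r, q + r}" for s
    using that keys_add[of q r] by (intro moment_functional_superset) auto
  then show ?thesis
    by (simp add: lookup_add algebra_simps sum.distrib)
qed

lemma moment_functional_zero [simp]: "moment_functional z 0 = 0"
  by (simp add: moment_functional_def)

lemma moment_functional_single [simp]:
  "moment_functional z (Poly_Mapping.single \<alpha> c) = c * z \<alpha>"
  by (simp add: moment_functional_def)

lemma moment_functional_one [simp]: "moment_functional z 1 = z 0"
  by (simp add: moment_functional_def)

lemma moment_functional_sum: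
  "moment_functional z (\<Sum>i\<in>I. q i) = (\<Sum>i\<in>I. moment_functional z (q i))"
  by (induction I rule: infinite_finite_induct) (simp_all add: moment_functional_add)

lemma moment_functional_uminus: "moment_functional z (- q) = - moment_functional z q"
  using moment_functional_add[of z q "- q"] by simp

lemma moment_functional_diff:
  "moment_functional z (q - r) = moment_functional z q - moment_functional z r"
  using moment_functional_add[of z q "- r"] by (simp add: moment_functional_uminus)

text \<open>Splits a polynomial into its terms, so that products can be computed term by term with
  \<open>mult_single\<close>.\<close>

lemma sum_single_lookup:
  assumes "finite S" "Poly_Mapping.keys q \<subseteq> S"
  shows "(\<Sum>\<alpha>\<in>S. Poly_Mapping.single \<alpha> (Poly_Mapping.lookup q \<alpha>)) = q"
proof (rule poly_mapping_eqI)
  fix \<gamma>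
  show "Poly_Mapping.lookup (\<Sum>\<alpha>\<in>S. Poly_Mapping.single \<alpha> (Poly_Mapping.lookup q \<alpha>)) \<gamma>
      = Poly_Mapping.lookup q \<gamma>"
    using assms by (cases "\<gamma> \<in> S") (auto simp: lookup_sum lookup_single when_def in_keys_iff)
qed

text \<open>Multiplying by one term shifts the moment sequence by \<alpha>. The shift by 0 gives
  homogeneity for \<open>pconst\<close>; for the sequence \<open>expo_eval p\<close> the shift
  becomes a factor.\<close>

lemma moment_functional_single_mult:
  "moment_functional z (Poly_Mapping.single \<alpha> c * q)
    = (\<Sum>\<gamma>\<in>Poly_Mapping.keys q. c * Poly_Mapping.lookup q \<gamma> * z (\<alpha> + \<gamma>))"
proof -
  have "Poly_Mapping.single \<alpha> c * q
      = (\<Sum>\<gamma>\<in>Poly_Mapping.keys q.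
           Poly_Mapping.single \<alpha> c * Poly_Mapping.single \<gamma> (Poly_Mapping.lookup q \<gamma>))"
    by (simp flip: sum_distrib_left add: sum_single_lookup)
  then show ?thesis
    by (simp add: mult_single moment_functional_sum)
qed

lemma moment_functional_pconst_mult:
  "moment_functional z (pconst c * q) = c * moment_functional z q"
  by (simp add: pconst_def moment_functional_single_mult)
    (simp add: moment_functional_def sum_distrib_left mult.assoc)

lemma moment_functional_cong:
  "(\<And>\<alpha>. \<alpha> \<in> Poly_Mapping.keys q \<Longrightarrow> z \<alpha> = z' \<alpha>) \<Longrightarrow> moment_functional z q = moment_functional z' q"
  by (simp add: moment_functional_def)

lemma moment_functional_restrict:
  "Poly_Mapping.keys q \<subseteq> I \<Longrightarrow> moment_functional (restrict z I) q = moment_functional z q"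
  by (rule moment_functional_cong) auto

lemma expo_eval_superset:
  assumes "finite S" "Poly_Mapping.keys \<alpha> \<subseteq> S"
  shows "expo_eval p \<alpha> = (\<Prod>i\<in>S. p $ i ^ Poly_Mapping.lookup \<alpha> i)"
  unfolding expo_eval_def
  by (rule prod.mono_neutral_left) (use assms in \<open>auto simp: in_keys_iff\<close>)

lemma expo_eval_zero [simp]: "expo_eval p 0 = 1"
  by (simp add: expo_eval_def)

lemma expo_eval_evar [simp]: "expo_eval p (evar i) = p $ i"
  by (simp add: expo_eval_def evar_def)

lemma expo_eval_add: "expo_eval p (\<alpha> + \<gamma>) = expo_eval p \<alpha> * expo_eval p \<gamma>"
proof -
  let ?S = "Poly_Mapping.keys \<alpha> \<union> Poly_Mapping.keys \<gamma>"
  have "expo_eval p \<delta> = (\<Prod>i\<in>?S. p $ i ^ Poly_Mapping.lookup \<delta> i)" if "\<delta> \<in> {\<alpha>, \<gamma>, \<alpha> + \<gamma>}" for \<delta>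
    using that keys_add[of \<alpha> \<gamma>] by (intro expo_eval_superset) auto
  then show ?thesis
    by (simp add: lookup_add power_add prod.distrib)
qed

text \<open>The monomial values at a point form a moment sequence. Linearity of evaluation is
  inherited from the functional, and moment constraints for this sequence become polynomial
  constraints on the point.\<close>

lemma peval_eq_moment_functional: "peval q p = moment_functional (expo_eval p) q"
  by (simp add: peval_def moment_functional_def)

lemma peval_zero [simp]: "peval 0 p = 0"
  and peval_one [simp]: "peval 1 p = 1"
  and peval_add [simp]: "peval (q + r) p = peval q p + peval r p"
  and peval_diff [simp]: "peval (q - r) p = peval q p - peval r p"
  and peval_sum [simp]: "peval (\<Sum>i\<in>I. s i) p = (\<Sum>i\<in>I. peval (s i) p)"
  and peval_pconst [simp]: "peval (pconst c) p = c"
  and peval_pmonom [simp]: "peval (pmonom \<alpha>) p = expo_eval p \<alpha>"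
  and peval_pvar [simp]: "peval (pvar i) p = p $ i"
  by (simp_all add: peval_eq_moment_functional moment_functional_add moment_functional_diff
      moment_functional_sum pconst_def pvar_def pmonom_def)

text \<open>Unlike linearity, this rests on \<open>expo_eval_add\<close>, applied after the left
  factor is expanded into its terms.\<close>

lemma peval_mult [simp]: "peval (q * r) p = peval q p * peval r p"
proof -
  have "peval (q * r) p
      = (\<Sum>\<alpha>\<in>Poly_Mapping.keys q. peval (Poly_Mapping.single \<alpha> (Poly_Mapping.lookup q \<alpha>) * r) p)"
    by (simp flip: peval_sum sum_distrib_right add: sum_single_lookup)
  also have "\<dots> = (\<Sum>\<alpha>\<in>Poly_Mapping.keys q. Poly_Mapping.lookup q \<alpha> * expo_eval p \<alpha> * peval r p)"
    by (simp add: peval_eq_moment_functional moment_functional_single_mult expo_eval_add)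
      (simp add: moment_functional_def sum_distrib_left mult_ac)
  finally show ?thesis
    by (simp add: peval_def sum_distrib_right)
qed

lemma peval_power [simp]: "peval (q ^ k) p = peval q p ^ k"
  by (induction k) simp_all

lemma pmonom_0 [simp]: "pmonom 0 = 1"
  by (simp add: pmonom_def)

lemma pmonom_mult: "pmonom \<alpha> * pmonom \<gamma> = pmonom (\<alpha> + \<gamma>)"
  by (simp add: pmonom_def mult_single)

lemma moment_functional_pmonom [simp]: "moment_functional z (pmonom \<alpha>) = z \<alpha>"
  by (simp add: pmonom_def)

lemma keys_pmonom [simp]: "Poly_Mapping.keys (pmonom \<alpha>) = {\<alpha>}"
  by (simp add: pmonom_def)

section \<open>Exponents of bounded degree\<close>

lemma total_degree_superset:
  assumes "finite S" "Poly_Mapping.keys \<alpha> \<subseteq> S"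
  shows "total_degree \<alpha> = (\<Sum>i\<in>S. Poly_Mapping.lookup \<alpha> i)"
  unfolding total_degree_def
  by (rule sum.mono_neutral_left) (use assms in \<open>auto simp: in_keys_iff\<close>)

lemma total_degree_add: "total_degree (\<alpha> + \<gamma>) = total_degree \<alpha> + total_degree \<gamma>"
proof -
  let ?S = "Poly_Mapping.keys \<alpha> \<union> Poly_Mapping.keys \<gamma>"
  have "total_degree \<delta> = (\<Sum>i\<in>?S. Poly_Mapping.lookup \<delta> i)" if "\<delta> \<in> {\<alpha>, \<gamma>, \<alpha> + \<gamma>}" for \<delta>
    using that keys_add[of \<alpha> \<gamma>] by (intro total_degree_superset) auto
  then show ?thesis
    by (simp add: lookup_add sum.distrib)
qed

lemma zero_in_expos_upto [simp]: "0 \<in> expos_upto m d"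
  by (simp add: expos_upto_def total_degree_def)

lemma evar_in_expos_upto: "i < m \<Longrightarrow> d \<ge> 1 \<Longrightarrow> evar i \<in> expos_upto m d"
  by (simp add: expos_upto_def total_degree_def evar_def)

lemma expos_upto_mono: "m \<le> m' \<Longrightarrow> d \<le> d' \<Longrightarrow> expos_upto m d \<subseteq> expos_upto m' d'"
  by (auto simp: expos_upto_def)

lemma add_in_expos_upto:
  "\<alpha> \<in> expos_upto m d \<Longrightarrow> \<gamma> \<in> expos_upto m e \<Longrightarrow> \<alpha> + \<gamma> \<in> expos_upto m (d + e)"
  using keys_add[of \<alpha> \<gamma>] by (auto simp: expos_upto_def total_degree_add)

lemma expos_upto_0: "expos_upto m 0 = {0}"
proof -
  have "\<alpha> = 0" if "total_degree \<alpha> = 0" for \<alpha>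
    using that by (auto simp: total_degree_def in_keys_iff intro!: poly_mapping_eqI)
  then show ?thesis by (auto simp: expos_upto_def total_degree_def)
qed

text \<open>Peels off one occurring variable; this is the induction step for splitting exponents by
  degree.\<close>

lemma expos_upto_SucE:
  assumes "\<alpha> \<in> expos_upto m (Suc d)"
  obtains "\<alpha> \<in> expos_upto m d" | i \<gamma> where "i < m" "\<gamma> \<in> expos_upto m d" "\<alpha> = evar i + \<gamma>"
proof (cases "\<alpha> = 0")
  case False
  then obtain i where i: "i \<in> Poly_Mapping.keys \<alpha>" by fastforce
  \<comment> \<open>Subtraction of exponents is truncated, but \<open>i\<close> occurs in \<alpha>,
    so adding \<open>evar i\<close> back recovers \<alpha>.\<close>
  let ?\<gamma> = "\<alpha> - evar i"
  have eq: "\<alpha> = evar i + ?\<gamma>"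
    using i by (intro poly_mapping_eqI) (auto simp: lookup_add lookup_minus evar_def lookup_single when_def in_keys_iff)
  have "Poly_Mapping.keys ?\<gamma> \<subseteq> Poly_Mapping.keys \<alpha>"
    by (auto simp: in_keys_iff lookup_minus)
  moreover have "total_degree \<alpha> = Suc (total_degree ?\<gamma>)"
    by (subst eq, subst total_degree_add) (simp add: total_degree_def evar_def)
  ultimately have "?\<gamma> \<in> expos_upto m d" "i < m"
    using assms i by (auto simp: expos_upto_def)
  then show ?thesis using that(2) eq by blast
qed (use that in auto)

lemma expos_upto_1: "expos_upto m 1 = insert 0 (evar ` {..<m})"
proof -
  have "\<alpha> \<in> insert 0 (evar ` {..<m})" if "\<alpha> \<in> expos_upto m (Suc 0)" for \<alpha>
    using that by (rule expos_upto_SucE) (auto simp: expos_upto_0)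
  then show ?thesis by (auto intro: evar_in_expos_upto)
qed

text \<open>Isolates the linear exponents to which the equation 1 - \<theta>_i^2 = 0 is applied when
  moments are bounded.\<close>

lemma theta_exponentE:
  assumes "\<gamma> \<notin> expos_upto n 1" "\<gamma> \<in> expos_upto (n + N) 1"
  obtains i where "\<gamma> = evar (n + i)" "i < N"
proof -
  obtain j where j: "\<gamma> = evar j" "j < n + N"
    using assms unfolding expos_upto_1 by blast
  moreover have "\<not> j < n"
    using assms(1) j(1) by (auto intro: evar_in_expos_upto)
  ultimately show ?thesis
    using that[of "j - n"] by simp
qed

text \<open>Induction on \<open>d\<close>: each variable peeled off goes into the first summand
  until that is full.\<close>

lemma expos_upto_addE:
  assumes "\<alpha> \<in> expos_upto m (d + e)"
  obtains \<gamma> \<delta> where "\<gamma> \<in> expos_upto m d" "\<delta> \<in> expos_upto m e" "\<alpha> = \<gamma> + \<delta>"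
proof -
  have "\<exists>\<gamma>\<in>expos_upto m d. \<exists>\<delta>\<in>expos_upto m e. \<alpha> = \<gamma> + \<delta>"
    using assms
  proof (induction d arbitrary: \<alpha>)
    case 0
    then show ?case by (auto simp: expos_upto_0)
  next
    case (Suc d)
    from Suc.prems have "\<alpha> \<in> expos_upto m (Suc (d + e))" by simp
    then show ?case
    proof (cases rule: expos_upto_SucE)
      case 1
      then show ?thesis
        using Suc.IH expos_upto_mono[of m m d "Suc d"] by fastforce
    next
      case (2 i \<gamma>)
      then obtain \<gamma>' \<delta> where "\<gamma>' \<in> expos_upto m d" "\<delta> \<in> expos_upto m e" "\<gamma> = \<gamma>' + \<delta>"
        using Suc.IH by blast
      then show ?thesis
        using add_in_expos_upto[OF evar_in_expos_upto[of i m 1], of \<gamma>' d] 2 by simp (metis add.assoc)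
    qed
  qed
  then show ?thesis using that by blast
qed

lemma expos_upto_2: "expos_upto m 2 = {\<alpha> + \<gamma> | \<alpha> \<gamma>. \<alpha> \<in> expos_upto m 1 \<and> \<gamma> \<in> expos_upto m 1}"
proof
  show "expos_upto m 2 \<subseteq> {\<alpha> + \<gamma> | \<alpha> \<gamma>. \<alpha> \<in> expos_upto m 1 \<and> \<gamma> \<in> expos_upto m 1}"
  proof
    fix \<alpha> assume "\<alpha> \<in> expos_upto m 2"
    then have "\<alpha> \<in> expos_upto m (1 + 1)" by (simp only: one_add_one)
    then show "\<alpha> \<in> {\<alpha> + \<gamma> | \<alpha> \<gamma>. \<alpha> \<in> expos_upto m 1 \<and> \<gamma> \<in> expos_upto m 1}"
      by (rule expos_upto_addE) blast
  qed
  show "{\<alpha> + \<gamma> | \<alpha> \<gamma>. \<alpha> \<in> expos_upto m 1 \<and> \<gamma> \<in> expos_upto m 1} \<subseteq> expos_upto m 2"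
    using add_in_expos_upto[of _ m 1 _ 1] unfolding one_add_one by blast
qed

section \<open>The monomials of the sparse relaxation\<close>

lemma set_mons_upto [simp]: "set (mons_upto m d) = expos_upto m d"
  by (simp add: mons_upto_def finite_expos_upto)

lemma set_mons_Bx [simp]: "set (mons_Bx n) = expos_upto n 1"
  unfolding expos_upto_1 by (auto simp: mons_Bx_def)

lemma set_mons_B:
  "set (mons_B n N) = {\<alpha> + \<gamma> | \<alpha> \<gamma>. \<alpha> \<in> expos_upto n 1 \<and> \<gamma> \<in> expos_upto (n + N) 1}"
    (is "_ = ?S")
proof
  have S: "\<alpha> + \<gamma> \<in> ?S" if "\<alpha> = 0 \<or> (\<exists>i<n. \<alpha> = evar i)" "\<gamma> = 0 \<or> (\<exists>i<n + N. \<gamma> = evar i)" for \<alpha> \<gamma>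
    using that unfolding expos_upto_1 by blast
  have "0 \<in> ?S" "evar i \<in> ?S" if "i < n + N" for i
    using S[of 0 0] S[of 0 "evar i"] that by auto
  moreover have "evar i + evar j \<in> ?S" if "i < n" "j < n + N" for i j
    using S that by blast
  \<comment> \<open>The last block writes the \<theta> factor first, whereas \<open>?S\<close> has
    the x factor first.\<close>
  moreover have "evar (n + i) + evar j \<in> ?S" if "i < N" "j < n" for i j
    using that by (subst add.commute[of "evar (n + i)" "evar j"], intro S) (auto simp: exI[of _ "n + i"])
  moreover have "0 \<in> ?S" using S[of 0 0] by simp
  ultimately show "set (mons_B n N) \<subseteq> ?S"
    unfolding mons_B_def by auto
next
  show "?S \<subseteq> set (mons_B n N)"
  proof
    fix \<delta> assume "\<delta> \<in> ?S"
    then obtain \<alpha> \<gamma> where \<delta>: "\<delta> = \<alpha> + \<gamma>" "\<alpha> = 0 \<or> (\<exists>i<n. \<alpha> = evar i)" "\<gamma> = 0 \<or> (\<exists>j<n + N. \<gamma> = evar j)"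
      unfolding expos_upto_1 by auto
    have 1: "evar i \<in> set (mons_B n N)" if "i < n + N" for i
      using that by (cases "i < n") (simp_all add: mons_B_def)
    have 2: "evar i + evar j \<in> set (mons_B n N)" if "i \<le> j" "j < n" for i j
      using that by (auto simp: mons_B_def intro!: bexI[of _ i])
    \<comment> \<open>The block (x)_2 lists each product once, with \<open>i \<le> j\<close>, so the
      indices are put in order.\<close>
    have 3: "evar i + evar j \<in> set (mons_B n N)" if "i < n" "j < n" for i j
      using 2[of i j] 2[of j i] that by (cases "i \<le> j") (auto simp: add.commute)
    \<comment> \<open>An index \<open>j \<ge> n\<close> belongs to \<theta>; its offset
      \<open>j - n\<close> is its position in the last block.\<close>
    have 4: "evar i + evar j \<in> set (mons_B n N)" if "i < n" "n \<le> j" "j < n + N" for i j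
    proof -
      have "evar (n + (j - n)) + evar i \<in> set (mons_B n N)" if "j - n < N"
        using \<open>i < n\<close> that
        by (auto simp: mons_B_def simp del: le_add_diff_inverse intro!: bexI[of _ "j - n"])
      then show ?thesis using that by (auto simp: add.commute)
    qed
    have 5: "0 \<in> set (mons_B n N)" by (simp add: mons_B_def)
    have 6: "evar i + evar j \<in> set (mons_B n N)" if "i < n" "j < n + N" for i j
      using 3[of i j] 4[of i j] that by (cases "j < n") auto
    show "\<delta> \<in> set (mons_B n N)"
      using \<delta>(2,3) unfolding \<delta>(1) by (auto simp: 1 5 6)
  qed
qed

lemma add_in_mons_B:
  "\<alpha> \<in> expos_upto n 1 \<Longrightarrow> \<gamma> \<in> expos_upto (n + N) 1 \<Longrightarrow> \<alpha> + \<gamma> \<in> set (mons_B n N)"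
  by (auto simp: set_mons_B)

lemma mons_B_subset_expos_upto: "set (mons_B n N) \<subseteq> expos_upto (n + N) 2"
  using expos_upto_mono[of n "n + N" 1 1, OF le_add1 order.refl]
  unfolding set_mons_B expos_upto_2 by blast

lemma expos_upto_subset_mons_B:
  shows "expos_upto n 2 \<subseteq> set (mons_B n N)" and "expos_upto (n + N) 1 \<subseteq> set (mons_B n N)"
proof -
  show "expos_upto n 2 \<subseteq> set (mons_B n N)"
    using expos_upto_mono[of n "n + N" 1 1, OF le_add1 order.refl]
    unfolding set_mons_B expos_upto_2 by blast
  show "expos_upto (n + N) 1 \<subseteq> set (mons_B n N)"
    using add_in_mons_B[of 0] by fastforce
qed

lemma finite_expo_double [simp]: "finite (expo_double S)"
proof -
  have "expo_double S = (\<lambda>(\<alpha>, \<gamma>). \<alpha> + \<gamma>) ` (set S \<times> set S)"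
    by (auto simp: expo_double_def)
  then show ?thesis by simp
qed

lemma add_in_expo_double: "\<alpha> \<in> set S \<Longrightarrow> \<gamma> \<in> set S \<Longrightarrow> \<alpha> + \<gamma> \<in> expo_double S"
  by (auto simp: expo_double_def)

lemma mons_B_subset_double: "set (mons_B n N) \<subseteq> expo_double (mons_B n N)"
proof
  fix \<alpha> assume "\<alpha> \<in> set (mons_B n N)"
  then have "0 + \<alpha> \<in> expo_double (mons_B n N)"
    by (rule add_in_expo_double[rotated]) (simp add: mons_B_def)
  then show "\<alpha> \<in> expo_double (mons_B n N)" by simp
qed

lemma evar_in_double: "i < n + N \<Longrightarrow> evar i \<in> expo_double (mons_B n N)"
  by (rule subsetD[OF mons_B_subset_double], rule subsetD[OF expos_upto_subset_mons_B(2)])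
    (simp add: evar_in_expos_upto)

text \<open>Splitting \<open>\<alpha>\<close> into two factors of degree one and giving one of them to each of \<open>\<gamma>\<close> and \<open>\<delta>\<close>
  yields two elements of \<open>\<B>\<close>.\<close>

lemma quadratic_times_linear_in_double:
  assumes "\<alpha> \<in> expos_upto n 2" "\<gamma> \<in> expos_upto (n + N) 1" "\<delta> \<in> expos_upto (n + N) 1"
  shows "\<alpha> + (\<gamma> + \<delta>) \<in> expo_double (mons_B n N)"
proof -
  obtain \<alpha>1 \<alpha>2 where "\<alpha>1 \<in> expos_upto n 1" "\<alpha>2 \<in> expos_upto n 1" "\<alpha> = \<alpha>1 + \<alpha>2"
    using assms(1) unfolding expos_upto_2 by blast
  then show ?thesis
    using add_in_expo_double[OF add_in_mons_B[of \<alpha>1 n \<gamma> N] add_in_mons_B[of \<alpha>2 n \<delta> N]] assms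
    by (simp add: add_ac)
qed

lemma expo_double_mons_B_subset: "expo_double (mons_B n N) \<subseteq> expos_upto (n + N) 4"
  using mons_B_subset_expos_upto add_in_expos_upto[of _ "n + N" 2 _ 2]
  by (fastforce simp: expo_double_def)

section \<open>Localizing matrices\<close>

lemma localizing_mat_carrier [simp]:
  "localizing_mat S q z \<in> carrier_mat (length S) (length S)"
  "dim_row (localizing_mat S q z) = length S" "dim_col (localizing_mat S q z) = length S"
  by (simp_all add: localizing_mat_def)

lemma transpose_localizing_mat: "transpose_mat (localizing_mat S q z) = localizing_mat S q z"
  by (rule eq_matI) (simp_all add: localizing_mat_def mult.commute)

lemma localizing_mat_eq_zero_iff:
  "localizing_mat S q z = 0\<^sub>m (length S) (length S) \<longleftrightarrow>
   (\<forall>\<alpha>\<in>set S. \<forall>\<gamma>\<in>set S. moment_functional z (q * (pmonom \<alpha> * pmonom \<gamma>)) = 0)"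
proof
  assume eq: "localizing_mat S q z = 0\<^sub>m (length S) (length S)"
  have "moment_functional z (q * (pmonom (S ! i) * pmonom (S ! j))) = 0"
    if "i < length S" "j < length S" for i j
    using arg_cong[OF eq, of "\<lambda>A. A $$ (i, j)"] that by (simp add: localizing_mat_def)
  then show "\<forall>\<alpha>\<in>set S. \<forall>\<gamma>\<in>set S. moment_functional z (q * (pmonom \<alpha> * pmonom \<gamma>)) = 0"
    by (metis in_set_conv_nth)
qed (auto intro!: eq_matI simp: localizing_mat_def)

text \<open>With \<open>v\<close> read as the coefficient vector of a polynomial r, the quadratic
  form v^T M v is the functional at q r^2, by bilinearity.\<close>

lemma localizing_quadratic_form:
  assumes "v \<in> carrier_vec (length S)"
  shows "v \<bullet> (localizing_mat S q z *\<^sub>v v)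
    = moment_functional z (q * ((\<Sum>i<length S. pconst (v $ i) * pmonom (S ! i))
                              * (\<Sum>i<length S. pconst (v $ i) * pmonom (S ! i))))"
proof -
  have "q * ((\<Sum>i<length S. pconst (v $ i) * pmonom (S ! i))
           * (\<Sum>j<length S. pconst (v $ j) * pmonom (S ! j)))
      = (\<Sum>i<length S. \<Sum>j<length S.
           pconst (v $ i) * (pconst (v $ j) * (q * (pmonom (S ! i) * pmonom (S ! j)))))"
    by (simp add: sum_product sum_distrib_left mult_ac)
  then have "moment_functional z (q * ((\<Sum>i<length S. pconst (v $ i) * pmonom (S ! i))
           * (\<Sum>j<length S. pconst (v $ j) * pmonom (S ! j))))
      = (\<Sum>i<length S. \<Sum>j<length S. v $ i * (v $ j *
           moment_functional z (q * (pmonom (S ! i) * pmonom (S ! j)))))"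
    by (simp add: moment_functional_sum moment_functional_pconst_mult)
  with assms show ?thesis
    by (simp add: scalar_prod_def sum_distrib_left localizing_mat_def lessThan_atLeast0 mult_ac)
qed

text \<open>Makes the vectors in the quadratic form range over all test polynomials supported on
  \<open>S\<close>.\<close>

lemma polynomial_as_combination:
  fixes r :: rpoly
  assumes "Poly_Mapping.keys r \<subseteq> set S"
  obtains v where "v \<in> carrier_vec (length S)"
    "r = (\<Sum>i<length S. pconst (v $ i) * pmonom (S ! i))"
proof -
  have "\<forall>\<alpha>\<in>set S. \<exists>i. i < length S \<and> S ! i = \<alpha>"
    by (simp add: in_set_conv_nth)
  \<comment> \<open>The list \<open>S\<close> may repeat exponents. \<open>idx\<close> selects one
    position for each; \<open>v\<close> puts the whole coefficient there and 0 at the other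
    positions.\<close>
  then obtain idx where idx: "\<And>\<alpha>. \<alpha> \<in> set S \<Longrightarrow> idx \<alpha> < length S \<and> S ! idx \<alpha> = \<alpha>"
    by metis
  define v where
    "v = vec (length S) (\<lambda>i. if idx (S ! i) = i then Poly_Mapping.lookup r (S ! i) else 0)"
  have "(\<Sum>i<length S. pconst (v $ i) * pmonom (S ! i))
      = (\<Sum>i\<in>idx ` set S. Poly_Mapping.single (S ! i) (Poly_Mapping.lookup r (S ! i)))"
  proof (rule sum.mono_neutral_cong_right)
    show "\<forall>i\<in>{..<length S} - idx ` set S. pconst (v $ i) * pmonom (S ! i) = 0"
    proof
      fix i assume i: "i \<in> {..<length S} - idx ` set S"
      then have "idx (S ! i) \<noteq> i" by (metis DiffD1 DiffD2 image_eqI lessThan_iff nth_mem)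
      then show "pconst (v $ i) * pmonom (S ! i) = 0"
        using i by (simp add: v_def pconst_def)
    qed
  qed (use idx in \<open>auto simp: v_def pconst_def pmonom_def mult_single\<close>)
  also have "\<dots> = (\<Sum>\<alpha>\<in>set S. Poly_Mapping.single \<alpha> (Poly_Mapping.lookup r \<alpha>))"
    by (subst sum.reindex) (use idx in \<open>auto intro!: inj_onI sum.cong, metis\<close>)
  also have "\<dots> = r"
    using assms by (intro sum_single_lookup) auto
  finally show ?thesis
    using that[of v] by (simp add: v_def)
qed

text \<open>The quadratic form identity turns semidefiniteness into nonnegativity on
  \<open>q\<close> times squares; symmetry is automatic because monomials commute. Matrices reappear
  only for the rank condition.\<close>

lemma psd_localizing_mat_iff:
  "psd_mat (localizing_mat S q z) \<longleftrightarrow>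
   (\<forall>r. Poly_Mapping.keys r \<subseteq> set S \<longrightarrow> 0 \<le> moment_functional z (q * (r * r)))"
proof -
  have keys: "Poly_Mapping.keys (\<Sum>i<length S. pconst (f i) * pmonom (S ! i)) \<subseteq> set S" for f
    using keys_sum[of "\<lambda>i. pconst (f i) * pmonom (S ! i)" "{..<length S}"]
    by (fastforce simp: pconst_def pmonom_def mult_single split: if_splits)
  have "psd_mat (localizing_mat S q z) \<longleftrightarrow>
    (\<forall>v\<in>carrier_vec (length S). 0 \<le> v \<bullet> (localizing_mat S q z *\<^sub>v v))"
    by (simp add: psd_mat_def transpose_localizing_mat)
  also have "\<dots> \<longleftrightarrow> (\<forall>r. Poly_Mapping.keys r \<subseteq> set S \<longrightarrow> 0 \<le> moment_functional z (q * (r * r)))"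
  proof (intro iffI allI impI ballI)
    fix r :: rpoly assume "\<forall>v\<in>carrier_vec (length S). 0 \<le> v \<bullet> (localizing_mat S q z *\<^sub>v v)"
      "Poly_Mapping.keys r \<subseteq> set S"
    moreover from this(2) obtain v where "v \<in> carrier_vec (length S)"
      "r = (\<Sum>i<length S. pconst (v $ i) * pmonom (S ! i))"
      by (rule polynomial_as_combination)
    ultimately show "0 \<le> moment_functional z (q * (r * r))"
      by (simp only: localizing_quadratic_form[symmetric])
  next
    fix v :: "real vec"
    assume "\<forall>r. Poly_Mapping.keys r \<subseteq> set S \<longrightarrow> 0 \<le> moment_functional z (q * (r * r))"
      "v \<in> carrier_vec (length S)"
    then show "0 \<le> v \<bullet> (localizing_mat S q z *\<^sub>v v)"
      using keys by (simp only: localizing_quadratic_form)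
  qed
  finally show ?thesis .
qed

text \<open>Matrix-free form of the relaxation: a constraint is used by choosing a test polynomial
  or a pair of monomials.\<close>

lemma sparse_feasible_iff:
  "z \<in> sparse_feasible N P \<longleftrightarrow>
     z \<in> extensional (expo_double (mons_B (xdim P) N)) \<and> z 0 = 1 \<and>
     (\<forall>r. Poly_Mapping.keys r \<subseteq> set (mons_B (xdim P) N) \<longrightarrow> 0 \<le> moment_functional z (r * r)) \<and>
     (\<forall>h\<in>h_x P. \<forall>\<alpha>\<in>expos_upto (xdim P + N) 1. \<forall>\<gamma>\<in>expos_upto (xdim P + N) 1.
        moment_functional z (h * (pmonom \<alpha> * pmonom \<gamma>)) = 0) \<and>
     (\<forall>h\<in>h_theta N P. \<forall>\<alpha>\<in>expos_upto (xdim P) 1. \<forall>\<gamma>\<in>expos_upto (xdim P) 1.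
        moment_functional z (h * (pmonom \<alpha> * pmonom \<gamma>)) = 0) \<and>
     (\<forall>g\<in>g_ineq P. \<forall>r. Poly_Mapping.keys r \<subseteq> expos_upto (xdim P + N) 1 \<longrightarrow>
        0 \<le> moment_functional z (g * (r * r)))"
  by (simp add: sparse_feasible_def Let_def psd_localizing_mat_iff localizing_mat_eq_zero_iff)

lemma dense_feasible_iff:
  "z \<in> dense_feasible N P \<longleftrightarrow>
     z \<in> extensional (expos_upto (xdim P + N) 4) \<and> z 0 = 1 \<and>
     (\<forall>r. Poly_Mapping.keys r \<subseteq> expos_upto (xdim P + N) 2 \<longrightarrow> 0 \<le> moment_functional z (r * r)) \<and>
     (\<forall>h\<in>h_x P \<union> h_theta N P. \<forall>\<alpha>\<in>expos_upto (xdim P + N) 1. \<forall>\<gamma>\<in>expos_upto (xdim P + N) 1.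
        moment_functional z (h * (pmonom \<alpha> * pmonom \<gamma>)) = 0) \<and>
     (\<forall>g\<in>g_ineq P. \<forall>r. Poly_Mapping.keys r \<subseteq> expos_upto (xdim P + N) 1 \<longrightarrow>
        0 \<le> moment_functional z (g * (r * r)))"
  by (simp add: dense_feasible_def Let_def psd_localizing_mat_iff localizing_mat_eq_zero_iff)

section \<open>The data of the four problems\<close>

definition polys_upto :: "nat \<Rightarrow> nat \<Rightarrow> rpoly set" where
  "polys_upto m d = {q. Poly_Mapping.keys q \<subseteq> expos_upto m d}"

lemma polys_upto_mono: "m \<le> m' \<Longrightarrow> d \<le> d' \<Longrightarrow> polys_upto m d \<subseteq> polys_upto m' d'"
  using expos_upto_mono unfolding polys_upto_def by blast

lemma pconst_in_polys_upto: "pconst c \<in> polys_upto m d"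
  by (auto simp: polys_upto_def pconst_def)

lemma numeral_eq_pconst: "(numeral k :: rpoly) = pconst (numeral k)"
  and one_eq_pconst: "(1 :: rpoly) = pconst 1"
  by (simp_all add: pconst_def)

lemma numeral_in_polys_upto: "numeral k \<in> polys_upto m d"
  and one_in_polys_upto: "1 \<in> polys_upto m d"
  using pconst_in_polys_upto by (simp_all only: numeral_eq_pconst one_eq_pconst)

lemma pvar_in_polys_upto: "i < m \<Longrightarrow> pvar i \<in> polys_upto m 1"
  by (simp add: polys_upto_def pvar_def pmonom_def evar_in_expos_upto)

lemma add_in_polys_upto: "q \<in> polys_upto m d \<Longrightarrow> r \<in> polys_upto m d \<Longrightarrow> q + r \<in> polys_upto m d"
  using keys_add[of q r] by (auto simp: polys_upto_def)

lemma diff_in_polys_upto: "q \<in> polys_upto m d \<Longrightarrow> r \<in> polys_upto m d \<Longrightarrow> q - r \<in> polys_upto m d"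
  using keys_diff[of q r] by (auto simp: polys_upto_def)

lemma sum_in_polys_upto:
  "(\<And>i. i \<in> I \<Longrightarrow> q i \<in> polys_upto m d) \<Longrightarrow> (\<Sum>i\<in>I. q i) \<in> polys_upto m d"
  using keys_sum[of q I] by (force simp: polys_upto_def)

lemma mult_in_polys_upto:
  "q \<in> polys_upto m d \<Longrightarrow> r \<in> polys_upto m e \<Longrightarrow> q * r \<in> polys_upto m (d + e)"
  using keys_mult[of q r] unfolding polys_upto_def by (fastforce dest: add_in_expos_upto)

lemma linear_mult_in_polys_upto:
  "q \<in> polys_upto m 1 \<Longrightarrow> r \<in> polys_upto m 1 \<Longrightarrow> q * r \<in> polys_upto m 2"
  using mult_in_polys_upto[of q m 1 r 1] by (simp only: one_add_one)

lemma const_mult_in_polys_upto: "q \<in> polys_upto m d \<Longrightarrow> pconst c * q \<in> polys_upto m d"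
  and numeral_mult_in_polys_upto: "q \<in> polys_upto m d \<Longrightarrow> numeral k * q \<in> polys_upto m d"
  and mult_const_in_polys_upto: "q \<in> polys_upto m d \<Longrightarrow> q * pconst c \<in> polys_upto m d"
  using mult_in_polys_upto[OF pconst_in_polys_upto, where d = 0]
    mult_in_polys_upto[OF _ pconst_in_polys_upto, where e = 0]
  by (simp_all add: numeral_eq_pconst)

lemma scalar_prod_in_polys_upto:
  assumes "\<And>i. i < dim_vec w \<Longrightarrow> v $ i \<in> polys_upto m 1" "\<And>i. i < dim_vec w \<Longrightarrow> w $ i \<in> polys_upto m 1"
  shows "v \<bullet> w \<in> polys_upto m 2"
  using assms unfolding scalar_prod_def by (intro sum_in_polys_upto linear_mult_in_polys_upto) auto

text \<open>\<open>scalar_prod\<close> sums over the dimension of its second argument; comparing the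
  dimensions keeps the entries of \<open>cvec v\<close> in range, hence constant.\<close>

lemma cvec_scalar_prod_in_polys_upto:
  assumes "dim_vec w \<le> dim_vec v" "\<And>i. i < dim_vec w \<Longrightarrow> w $ i \<in> polys_upto m d"
  shows "cvec v \<bullet> w \<in> polys_upto m d"
  unfolding scalar_prod_def
  by (intro sum_in_polys_upto) (use assms in \<open>auto intro!: const_mult_in_polys_upto\<close>)

lemma mult_cvec_in_polys_upto:
  assumes "dim_col A = dim_vec v" "i < dim_row A"
    "\<And>j. j < dim_col A \<Longrightarrow> A $$ (i, j) \<in> polys_upto m d"
  shows "(A *\<^sub>v cvec v) $ i \<in> polys_upto m d"
  using assms unfolding scalar_prod_def index_mult_mat_vec[OF assms(2)]
  by (intro sum_in_polys_upto) (auto intro!: mult_const_in_polys_upto)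

lemma rot_in_polys_upto: "i < 3 \<Longrightarrow> j < 3 \<Longrightarrow> m \<ge> 9 \<Longrightarrow> rot $$ (i, j) \<in> polys_upto m 1"
  by (simp add: rot_def) (intro pvar_in_polys_upto[unfolded One_nat_def], linarith)

lemma affine_rot_in_polys_upto: "i < 2 \<Longrightarrow> j < 3 \<Longrightarrow> affine_rot $$ (i, j) \<in> polys_upto 6 1"
  by (simp add: affine_rot_def) (intro pvar_in_polys_upto[unfolded One_nat_def], linarith)

lemma transl_in_polys_upto: "i < 3 \<Longrightarrow> transl $ i \<in> polys_upto 12 1"
  by (simp add: transl_def) (intro pvar_in_polys_upto[unfolded One_nat_def], linarith)

lemma dims [simp]:
  "dim_row rot = 3" "dim_col rot = 3" "dim_row affine_rot = 2" "dim_col affine_rot = 3"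
  "dim_vec transl = 3" "dim_vec (xvec n) = n" "dim_vec (cross_vec a b) = 3"
  by (simp_all add: rot_def affine_rot_def transl_def xvec_def cross_vec_def)

lemma cross_vec_index:
  "cross_vec a b $ 0 = a $ 1 * b $ 2 - a $ 2 * b $ 1"
  "cross_vec a b $ 1 = a $ 2 * b $ 0 - a $ 0 * b $ 2"
  "cross_vec a b $ 2 = a $ 0 * b $ 1 - a $ 1 * b $ 0"
  by (simp_all add: cross_vec_def vec_of_list_index numeral_2_eq_2)

lemma less_3_cases: "k < (3 :: nat) \<Longrightarrow> k = 0 \<or> k = 1 \<or> k = 2"
  by linarith

lemma cross_vec_in_polys_upto:
  assumes "\<And>i. i < 3 \<Longrightarrow> a $ i \<in> polys_upto m 1" "\<And>i. i < 3 \<Longrightarrow> b $ i \<in> polys_upto m 1" "k < 3"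
  shows "cross_vec a b $ k \<in> polys_upto m 2"
  using less_3_cases[OF assms(3)]
  by (elim disjE) (simp_all only: cross_vec_index,
      (intro diff_in_polys_upto linear_mult_in_polys_upto assms; simp)+)

lemma h_rot_subset_polys_upto:
  assumes "m \<ge> 9"
  shows "h_rot rot \<subseteq> polys_upto m 2"
proof -
  have col: "col rot j $ i \<in> polys_upto m 1" if "i < 3" "j < 3" for i j
    using rot_in_polys_upto[OF that assms] that by simp
  have col2: "col rot j $ i \<in> polys_upto m 2" if "i < 3" "j < 3" for i j
    using col[OF that] polys_upto_mono[of m m 1 2] by auto
  have sp: "col rot j \<bullet> col rot k \<in> polys_upto m 2" if "j < 3" "k < 3" for j k
    using that by (intro scalar_prod_in_polys_upto col) auto
  have cr: "(cross_vec (col rot i) (col rot j) - col rot k) $ l \<in> polys_upto m 2"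
    if "i < 3" "j < 3" "k < 3" "l < 3" for i j k l
    using that cross_vec_in_polys_upto[OF col col, of i j l] col2[of l k]
    by (simp add: diff_in_polys_upto)
  have "1 - q \<in> polys_upto m 2" if "q \<in> polys_upto m 2" for q
    using that by (intro diff_in_polys_upto one_in_polys_upto)
  then show ?thesis
    unfolding h_rot_def Let_def using sp cr by auto
qed

lemma h_x_subset_polys_upto: "h_x P \<subseteq> polys_upto (xdim P) 2"
proof (cases P)
  case (Shape_Alignment B b s)
  have "row affine_rot i \<bullet> row affine_rot j \<in> polys_upto 6 2" if "i < 2" "j < 2" for i j
    by (rule scalar_prod_in_polys_upto) (use that affine_rot_in_polys_upto in auto)
  then show ?thesis
    using Shape_Alignment by (simp add: Let_def diff_in_polys_upto)
qed (use h_rot_subset_polys_upto[of 9] h_rot_subset_polys_upto[of 12] in simp_all)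

lemma g_ineq_subset_polys_upto: "g_ineq P \<subseteq> polys_upto (xdim P) 2"
proof (cases P)
  case (Shape_Alignment B b s)
  have "row affine_rot i \<bullet> row affine_rot j \<in> polys_upto 6 2" if "i < 2" "j < 2" for i j
    by (rule scalar_prod_in_polys_upto) (use that affine_rot_in_polys_upto in auto)
  then show ?thesis
    using Shape_Alignment
    by (simp add: Let_def diff_in_polys_upto one_in_polys_upto const_mult_in_polys_upto add_in_polys_upto)
next
  case (Point_Cloud_Registration a b T)
  have "transl \<bullet> transl \<in> polys_upto 12 2"
    by (rule scalar_prod_in_polys_upto) (use transl_in_polys_upto in auto)
  then show ?thesis
    using Point_Cloud_Registration
    by (simp add: diff_in_polys_upto one_in_polys_upto const_mult_in_polys_upto)
next
  case (Mesh_Registration a b u v w T)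
  have "transl \<bullet> transl \<in> polys_upto 12 2"
    by (rule scalar_prod_in_polys_upto) (use transl_in_polys_upto in auto)
  then show ?thesis
    using Mesh_Registration
    by (simp add: diff_in_polys_upto one_in_polys_upto const_mult_in_polys_upto)
qed simp

text \<open>Rotation and translation entries are variables, so the highest terms are products of two
  linear polynomials. Admissibility fixes the dimensions of the data, which keeps all scalar
  products in range.\<close>

lemma residual_in_polys_upto:
  assumes "admissible_data N P" "i < N"
  shows "residual P i \<in> polys_upto (xdim P) 2"
proof -
  note intros = diff_in_polys_upto add_in_polys_upto numeral_in_polys_upto
    numeral_mult_in_polys_upto const_mult_in_polys_upto
  have linear: "q \<in> polys_upto m 2" if "q \<in> polys_upto m 1" for q m
    using that polys_upto_mono[of m m 1 2] by auto
  have const: "cvec a \<bullet> cvec b \<in> polys_upto m d" if "dim_vec a = dim_vec b" for a b :: "real vec" and m d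
    using that by (intro cvec_scalar_prod_in_polys_upto) (auto intro: pconst_in_polys_upto)
  have rot: "(rot *\<^sub>v cvec a) $ j \<in> polys_upto 12 1" if "a \<in> carrier_vec 3" "j < 3" for a j
    using that by (intro mult_cvec_in_polys_upto) (auto simp: rot_in_polys_upto[unfolded One_nat_def])
  have transl: "cvec a \<bullet> transl \<in> polys_upto 12 1" if "a \<in> carrier_vec 3" for a
    using that transl_in_polys_upto by (intro cvec_scalar_prod_in_polys_upto) auto
  have crot: "cvec a \<bullet> (rot *\<^sub>v cvec b) \<in> polys_upto 12 1"
    if "a \<in> carrier_vec 3" "b \<in> carrier_vec 3" for a b
    using that rot by (intro cvec_scalar_prod_in_polys_upto) auto
  show ?thesis
  proof (cases P)
    case (Single_Rotation_Averaging R)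
    then have "dim_vec (vectorize (R i)) = 9"
      using assms by (auto simp: SO3_def vectorize_def)
    then have "cvec (vectorize (R i)) \<bullet> xvec 9 \<in> polys_upto 9 1"
      by (intro cvec_scalar_prod_in_polys_upto) (auto simp: xvec_def pvar_in_polys_upto[unfolded One_nat_def])
    then show ?thesis
      using Single_Rotation_Averaging by (auto intro!: intros linear)
  next
    case (Shape_Alignment B b s)
    then have "B i \<in> carrier_vec 3" "b i \<in> carrier_vec 2" using assms by auto
    then have "(cvec (b i) - affine_rot *\<^sub>v cvec (B i)) $ j \<in> polys_upto 6 1" if "j < 2" for j
      using that mult_cvec_in_polys_upto[of affine_rot "B i" j 6 1] affine_rot_in_polys_upto
      by (auto intro!: intros pconst_in_polys_upto)
    then show ?thesis
      using Shape_Alignment by (auto simp: Let_def intro!: scalar_prod_in_polys_upto)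
  next
    case (Point_Cloud_Registration a b T)
    then have ab: "a i \<in> carrier_vec 3" "b i \<in> carrier_vec 3" using assms by auto
    have "transl \<bullet> transl \<in> polys_upto 12 2" "transl \<bullet> (rot *\<^sub>v cvec (a i)) \<in> polys_upto 12 2"
      using rot[OF ab(1)] transl_in_polys_upto by (auto intro!: scalar_prod_in_polys_upto)
    then show ?thesis
      using Point_Cloud_Registration ab
      by (auto simp: Let_def intro!: intros const linear[OF transl] linear[OF crot])
  next
    case (Mesh_Registration a b u v w T)
    then have "a i \<in> carrier_vec 3" "b i \<in> carrier_vec 3" "u i \<in> carrier_vec 3" "v i \<in> carrier_vec 3"
      using assms by auto
    then show ?thesis
      using Mesh_Registration
      by (auto simp: Let_def power2_eq_square
          intro!: intros const transl crot linear[OF crot] linear_mult_in_polys_upto)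
  qed
qed

text \<open>Localized constraints and the objective are built from products of this shape, so the
  functional sees only moments indexed by 2\<B>.\<close>

lemma keys_quadratic_times_linear:
  assumes "q \<in> polys_upto n 2" "r \<in> polys_upto (n + N) 1" "s \<in> polys_upto (n + N) 1"
  shows "Poly_Mapping.keys (q * (r * s)) \<subseteq> expo_double (mons_B n N)"
  using keys_mult[of q "r * s"] keys_mult[of r s] assms
  unfolding polys_upto_def by (fastforce dest: quadratic_times_linear_in_double)

lemma theta_in_polys_upto: "i < N \<Longrightarrow> theta P i \<in> polys_upto (xdim P + N) 1"
  unfolding theta_def by (rule pvar_in_polys_upto) simp

lemma keys_objective:
  assumes "admissible_data N P"
  shows "Poly_Mapping.keys (objective N \<beta> c P) \<subseteq> expo_double (mons_B (xdim P) N)"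
proof -
  have "Poly_Mapping.keys (pconst (1 / (2 * (\<beta> i)\<^sup>2)) * (1 + theta P i) * residual P i
            + pconst (c\<^sup>2 / 2) * (1 - theta P i)) \<subseteq> expo_double (mons_B (xdim P) N)"
    if "i < N" for i
  proof -
    \<comment> \<open>A residual, quadratic in x, meets one factor linear in \<theta>; the factor 1
      fills the free linear slot here, and also the quadratic slot of the second term.\<close>
    have "Poly_Mapping.keys (residual P i * (pconst (1 / (2 * (\<beta> i)\<^sup>2)) * (1 + theta P i) * 1))
        \<subseteq> expo_double (mons_B (xdim P) N)"
      by (intro keys_quadratic_times_linear residual_in_polys_upto const_mult_in_polys_upto
          add_in_polys_upto one_in_polys_upto theta_in_polys_upto)
        (use that assms in auto)
    moreover have "Poly_Mapping.keys (1 * (pconst (c\<^sup>2 / 2) * (1 - theta P i) * 1))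
        \<subseteq> expo_double (mons_B (xdim P) N)"
      by (intro keys_quadratic_times_linear const_mult_in_polys_upto
          diff_in_polys_upto one_in_polys_upto theta_in_polys_upto)
        (use that in auto)
    ultimately show ?thesis
      by (intro order.trans[OF keys_add]) (simp add: mult_ac)
  qed
  then show ?thesis
    unfolding objective_def by (intro order.trans[OF keys_sum]) blast
qed

section \<open>Consequences of the constraints: norm bounds and a feasible point\<close>

lemma sum_lessThan_3: "(\<Sum>i<3. f i) = f 0 + f 1 + f (2 :: nat)"
  by (simp add: lessThan_nat_numeral add_ac)

lemma sum_atLeast0_3: "(\<Sum>i=0..<3. f i) = f 0 + f 1 + f (2 :: nat)"
  using sum_lessThan_3 by (simp add: lessThan_atLeast0)

text \<open>The constraints of every instance bound the squared norm of \<open>x\<close> by a combination of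
  the equations with constant, and of the inequality with nonnegative constant, multipliers; such a
  bound survives multiplication by any \<open>s\<close> for which the localized constraints hold.\<close>

lemma moment_functional_sum_squares_le:
  assumes "admissible_data N P"
  obtains C where "C \<ge> 1"
    "\<And>z s. (\<And>h. h \<in> h_x P \<Longrightarrow> moment_functional z (h * s) = 0) \<Longrightarrow>
       (\<And>g. g \<in> g_ineq P \<Longrightarrow> 0 \<le> moment_functional z (g * s)) \<Longrightarrow> 0 \<le> moment_functional z s \<Longrightarrow>
       (\<Sum>i<xdim P. moment_functional z (pvar i * pvar i * s)) \<le> C * moment_functional z s"
proof -
  \<comment> \<open>Each of the three column norm equations contributes the value at
    \<open>s\<close> once, hence the factor 3.\<close>
  have rot: "(\<Sum>i<9. moment_functional z (pvar i * pvar i * s)) = 3 * moment_functional z s"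
    if "\<And>h. h \<in> h_rot rot \<Longrightarrow> moment_functional z (h * s) = 0" for z s
  proof -
    have "moment_functional z (col rot j \<bullet> col rot j * s) = moment_functional z s" if "j < 3" for j
    proof -
      have "1 - col rot j \<bullet> col rot j \<in> h_rot rot"
        using less_3_cases[OF \<open>j < 3\<close>] by (auto simp: h_rot_def Let_def)
      from \<open>\<And>h. h \<in> h_rot rot \<Longrightarrow> moment_functional z (h * s) = 0\<close>[OF this]
      show ?thesis by (simp add: left_diff_distrib moment_functional_diff)
    qed
    from this[of 0] this[of 1] this[of 2] show ?thesis
      by (simp add: scalar_prod_def sum_atLeast0_3 rot_def distrib_right moment_functional_add
          lessThan_nat_numeral)
  qed
  \<comment> \<open>The inequality bounds the translation part by \<open>T\<^sup>2\<close>, added to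
    the 3 from the rotation.\<close>
  have rigid: "(\<Sum>i<12. moment_functional z (pvar i * pvar i * s)) \<le> (3 + T\<^sup>2) * moment_functional z s"
    if "\<And>h. h \<in> h_rot rot \<Longrightarrow> moment_functional z (h * s) = 0" "T > 0"
      "0 \<le> moment_functional z ((1 - pconst (1 / T\<^sup>2) * (transl \<bullet> transl)) * s)" for z s T
  proof -
    have "moment_functional z (transl \<bullet> transl * s) / T\<^sup>2 \<le> moment_functional z s"
      using that(3) by (simp add: left_diff_distrib moment_functional_diff mult.assoc
          moment_functional_pconst_mult)
    then have "moment_functional z (transl \<bullet> transl * s) \<le> T\<^sup>2 * moment_functional z s"
      using \<open>T > 0\<close> by (simp add: pos_divide_le_eq mult.commute)
    with rot[OF that(1)] show ?thesis
      by (simp add: scalar_prod_def sum_atLeast0_3 transl_def distrib_right moment_functional_add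
          lessThan_nat_numeral)
  qed
  show ?thesis
  proof (cases P)
    case (Single_Rotation_Averaging R)
    then show ?thesis
      using that[of 3] rot by simp
  next
    case (Shape_Alignment B b t)
    \<comment> \<open>The inequality gives the bound \<open>2 * t\<^sup>2\<close>; the summand 1
      makes the constant at least 1.\<close>
    have "(\<Sum>i<6. moment_functional z (pvar i * pvar i * s)) \<le> (1 + 2 * t\<^sup>2) * moment_functional z s"
      if "\<And>g. g \<in> g_ineq P \<Longrightarrow> 0 \<le> moment_functional z (g * s)" "0 \<le> moment_functional z s" for z s
    proof -
      let ?q = "row affine_rot 0 \<bullet> row affine_rot 0 + row affine_rot 1 \<bullet> row affine_rot 1"
      have "t > 0" using assms Shape_Alignment by simp
      have "0 \<le> moment_functional z ((1 - pconst (1 / (2 * t\<^sup>2)) * ?q) * s)"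
        using that(1) Shape_Alignment by (simp add: Let_def)
      then have "moment_functional z (?q * s) / (2 * t\<^sup>2) \<le> moment_functional z s"
        by (simp add: left_diff_distrib moment_functional_diff mult.assoc moment_functional_pconst_mult)
      then have "moment_functional z (?q * s) \<le> 2 * t\<^sup>2 * moment_functional z s"
        using \<open>t > 0\<close> by (simp add: pos_divide_le_eq mult.commute)
      moreover have "moment_functional z (?q * s) = (\<Sum>i<6. moment_functional z (pvar i * pvar i * s))"
        by (simp add: scalar_prod_def sum_atLeast0_3 affine_rot_def distrib_right moment_functional_add
            lessThan_nat_numeral)
      ultimately show ?thesis using that(2) by (simp add: distrib_right)
    qed
    then show ?thesis
      using that[of "1 + 2 * t\<^sup>2"] Shape_Alignment by simp
  next
    case (Point_Cloud_Registration a b T)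
    then show ?thesis
      using that[of "3 + T\<^sup>2"] rigid[where T = T] assms by simp
  next
    case (Mesh_Registration a b u v w T)
    then show ?thesis
      using that[of "3 + T\<^sup>2"] rigid[where T = T] assms by simp
  qed
qed

lemma peval_scalar_prod: "peval (v \<bullet> w) p = (\<Sum>i=0..<dim_vec w. peval (v $ i) p * peval (w $ i) p)"
  by (simp add: scalar_prod_def)

lemma peval_scalar_prod_self_nonneg: "0 \<le> peval (v \<bullet> v) p"
  by (simp add: peval_scalar_prod sum_nonneg)

text \<open>Each inequality polynomial is 1 minus a nonnegative multiple of a sum of squares. The
  relaxations impose only nonnegativity of g; this supplies the upper bound in the POP.\<close>

lemma peval_g_ineq_le_1: "g \<in> g_ineq P \<Longrightarrow> peval g p \<le> 1"
  using peval_scalar_prod_self_nonneg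
  by (cases P) (auto simp: Let_def intro!: mult_nonneg_nonneg divide_nonneg_nonneg add_nonneg_nonneg)

lemma pop_feasible_nonempty: "pop_feasible N P \<noteq> {}"
proof -
  \<comment> \<open>The identity rotation, with diagonal at positions 0, 4, 8 of vec(R), and zero
    translation. \<open>9 \<le> xdim P\<close> singles out the instances with a rotation; shape
    alignment takes x = 0.\<close>
  define x :: "nat \<Rightarrow> real" where "x i = (if 9 \<le> xdim P \<and> i \<in> {0, 4, 8} then 1 else 0)" for i
  define p where "p = vec (xdim P + N) (\<lambda>i. if i < xdim P then x i else 1)"
  have theta: "peval h p = 0" if "h \<in> h_theta N P" for h
    using that by (auto simp: h_theta_def theta_def p_def)
  have x: "p $ i = x i" if "i < xdim P" for i
    using that by (simp add: p_def)
  have rot: "peval h p = 0" if "h \<in> h_rot rot" "xdim P \<ge> 9" for h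
  proof -
    have col: "peval (col rot j $ i) p = (if i = j then 1 else 0)" if "i < 3" "j < 3" for i j
      using less_3_cases[OF that(1)] less_3_cases[OF that(2)] \<open>xdim P \<ge> 9\<close>
      by (elim disjE) (simp_all add: rot_def x x_def)
    have dot: "peval (col rot j \<bullet> col rot k) p = (if j = k then 1 else 0)" if "j < 3" "k < 3" for j k
      using less_3_cases[OF that(1)] less_3_cases[OF that(2)]
      by (elim disjE) (simp_all add: peval_scalar_prod sum_atLeast0_3 col del: index_col)
    have cross: "peval ((cross_vec (col rot i) (col rot j) - col rot k) $ l) p = 0"
      if "(i, j, k) \<in> {(0, 1, 2), (1, 2, 0), (2, 0, 1)}" "l < 3" for i j k l
      using less_3_cases[OF that(2)] that(1)
      by (elim disjE) (auto simp: cross_vec_index cross_vec_index(2)[unfolded One_nat_def] col simp del: index_col)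
    show ?thesis
      using \<open>h \<in> h_rot rot\<close> unfolding h_rot_def Let_def by (auto simp: dot cross simp del: index_minus_vec)
  qed
  have transl: "peval (transl \<bullet> transl) p = 0" if "xdim P = 12"
    using that by (simp add: peval_scalar_prod sum_atLeast0_3 transl_def x x_def)
  have affine: "peval (row affine_rot i \<bullet> row affine_rot j) p = 0" if "xdim P = 6" "i < 2" "j < 2" for i j
    using that by (simp add: peval_scalar_prod sum_atLeast0_3 affine_rot_def x x_def)
  have "p \<in> pop_feasible N P"
  proof (cases P)
    case (Shape_Alignment B b s)
    then show ?thesis
      using theta affine by (auto simp: pop_feasible_def p_def Let_def)
  qed (use theta rot transl in \<open>auto simp: pop_feasible_def p_def\<close>)
  then show ?thesis by blast
qed

section \<open>Feasibility\<close>

lemma pmonom_in_polys_upto: "\<alpha> \<in> expos_upto m d \<Longrightarrow> pmonom \<alpha> \<in> polys_upto m d"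
  by (simp add: polys_upto_def)

text \<open>The roles are exchanged here: the two localizing monomials form the part quadratic in x,
  and \<theta>_i, taken twice, fills the linear slots. Localizing by [1, x] instead of [1, p] keeps
  the exponents in 2\<B>.\<close>

lemma keys_theta_localizer:
  assumes "h \<in> h_theta N P" "\<alpha> \<in> expos_upto (xdim P) 1" "\<gamma> \<in> expos_upto (xdim P) 1"
  shows "Poly_Mapping.keys (h * (pmonom \<alpha> * pmonom \<gamma>)) \<subseteq> expo_double (mons_B (xdim P) N)"
proof -
  obtain i where i: "i < N" "h = 1 - (theta P i)\<^sup>2"
    using assms(1) by (auto simp: h_theta_def)
  have q: "pmonom \<alpha> * pmonom \<gamma> \<in> polys_upto (xdim P) 2"
    using assms(2,3) by (intro linear_mult_in_polys_upto pmonom_in_polys_upto)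
  have "h * (pmonom \<alpha> * pmonom \<gamma>)
      = pmonom \<alpha> * pmonom \<gamma> * (1 * 1) - pmonom \<alpha> * pmonom \<gamma> * (theta P i * theta P i)"
    by (simp add: i(2) power2_eq_square algebra_simps)
  also have "Poly_Mapping.keys \<dots> \<subseteq> expo_double (mons_B (xdim P) N)"
    using keys_quadratic_times_linear[OF q one_in_polys_upto one_in_polys_upto]
      keys_quadratic_times_linear[OF q theta_in_polys_upto[OF i(1)] theta_in_polys_upto[OF i(1)]]
    by (intro order.trans[OF keys_diff]) simp
  finally show ?thesis .
qed

lemma keys_square_in_double:
  "Poly_Mapping.keys r \<subseteq> set S \<Longrightarrow> Poly_Mapping.keys (r * r) \<subseteq> expo_double S"
  using keys_mult[of r r] unfolding expo_double_def by blast

lemma zero_in_expo_double_mons_B: "0 \<in> expo_double (mons_B n N)"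
  using add_in_expo_double[of 0 "mons_B n N" 0] by (simp add: mons_B_def)

text \<open>The sparse constraints are dense constraints for fewer test polynomials, and every
  moment in them is indexed by 2\<B>, so restriction leaves their values unchanged.\<close>

lemma dense_restricts_to_sparse:
  assumes "z \<in> dense_feasible N P"
  shows "restrict z (expo_double (mons_B (xdim P) N)) \<in> sparse_feasible N P"
proof -
  let ?I = "expo_double (mons_B (xdim P) N)" and ?m = "xdim P + N"
  note z = assms[unfolded dense_feasible_iff]
  have "0 \<le> moment_functional (restrict z ?I) (r * r)"
    if r: "Poly_Mapping.keys r \<subseteq> set (mons_B (xdim P) N)" for r
    using z r mons_B_subset_expos_upto[of "xdim P" N]
    by (subst moment_functional_restrict[OF keys_square_in_double[OF r]]) blast
  moreover have "moment_functional (restrict z ?I) (h * (pmonom \<alpha> * pmonom \<gamma>)) = 0"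
    if "h \<in> h_x P" "\<alpha> \<in> expos_upto ?m 1" "\<gamma> \<in> expos_upto ?m 1" for h \<alpha> \<gamma>
    using that z h_x_subset_polys_upto[of P]
    by (subst moment_functional_restrict[OF keys_quadratic_times_linear])
      (auto intro: pmonom_in_polys_upto)
  moreover have "moment_functional (restrict z ?I) (h * (pmonom \<alpha> * pmonom \<gamma>)) = 0"
    if "h \<in> h_theta N P" "\<alpha> \<in> expos_upto (xdim P) 1" "\<gamma> \<in> expos_upto (xdim P) 1" for h \<alpha> \<gamma>
    using that z expos_upto_mono[of "xdim P" ?m 1 1, OF le_add1 order.refl]
    by (subst moment_functional_restrict[OF keys_theta_localizer]) blast+
  moreover have "0 \<le> moment_functional (restrict z ?I) (g * (r * r))"
    if "g \<in> g_ineq P" "Poly_Mapping.keys r \<subseteq> expos_upto ?m 1" for g r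
    using that z g_ineq_subset_polys_upto[of P]
    by (subst moment_functional_restrict[OF keys_quadratic_times_linear]) (auto simp: polys_upto_def)
  ultimately show ?thesis
    using z unfolding sparse_feasible_iff by (simp add: zero_in_expo_double_mons_B)
qed

text \<open>All polynomials in the constraints have degree at most 4, so the functional is
  evaluation at \<open>p\<close>, where the equations vanish and squares are nonnegative.\<close>

lemma pop_feasible_gives_dense:
  assumes "p \<in> pop_feasible N P"
  shows "restrict (expo_eval p) (expos_upto (xdim P + N) 4) \<in> dense_feasible N P"
proof -
  let ?m = "xdim P + N" and ?I = "expos_upto (xdim P + N) 4"
  have eval: "moment_functional (restrict (expo_eval p) ?I) q = peval q p" if "q \<in> polys_upto ?m 4" for q
    using that by (simp add: moment_functional_restrict polys_upto_def peval_eq_moment_functional)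
  have quad: "q * (r * s) \<in> polys_upto ?m 4"
    if "q \<in> polys_upto ?m 2" "r \<in> polys_upto ?m 1" "s \<in> polys_upto ?m 1" for q r s
    using mult_in_polys_upto[OF that(1) linear_mult_in_polys_upto[OF that(2,3)]] by simp
  have "h_theta N P \<subseteq> polys_upto ?m 2"
    by (auto simp: h_theta_def power2_eq_square simp del: One_nat_def
        intro!: diff_in_polys_upto one_in_polys_upto linear_mult_in_polys_upto theta_in_polys_upto)
  then have h: "h_x P \<union> h_theta N P \<subseteq> polys_upto ?m 2" and g: "g_ineq P \<subseteq> polys_upto ?m 2"
    using h_x_subset_polys_upto[of P] g_ineq_subset_polys_upto[of P]
      polys_upto_mono[of "xdim P" ?m 2 2] by auto
  have "moment_functional (restrict (expo_eval p) ?I) (h * (pmonom \<alpha> * pmonom \<gamma>)) = 0"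
    if "h \<in> h_x P \<union> h_theta N P" "\<alpha> \<in> expos_upto ?m 1" "\<gamma> \<in> expos_upto ?m 1" for h \<alpha> \<gamma>
    using that h assms
    by (subst eval[OF quad]) (auto simp: pop_feasible_def intro: pmonom_in_polys_upto)
  moreover have "0 \<le> moment_functional (restrict (expo_eval p) ?I) (r * r)"
    if "Poly_Mapping.keys r \<subseteq> expos_upto ?m 2" for r
    using mult_in_polys_upto[of r ?m 2 r 2] that by (subst eval) (simp_all add: polys_upto_def)
  moreover have "0 \<le> moment_functional (restrict (expo_eval p) ?I) (g * (r * r))"
    if "g \<in> g_ineq P" "Poly_Mapping.keys r \<subseteq> expos_upto ?m 1" for g r
    using that g assms
    by (subst eval[OF quad]) (auto simp: pop_feasible_def polys_upto_def)
  ultimately show ?thesis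
    unfolding dense_feasible_iff by simp
qed

lemma pop_feasible_gives_sparse:
  assumes "p \<in> pop_feasible N P"
  shows "restrict (expo_eval p) (expo_double (mons_B (xdim P) N)) \<in> sparse_feasible N P"
  using dense_restricts_to_sparse[OF pop_feasible_gives_dense[OF assms]]
    expo_double_mons_B_subset[of "xdim P" N]
  by (simp add: restrict_restrict Int_absorb1)

section \<open>Bounds on the moments\<close>

text \<open>The squares of the sum and of the difference of the two monomials bound an off-diagonal
  moment by the mean of two diagonal ones.\<close>

lemma abs_moment_le:
  assumes psd: "\<And>r. Poly_Mapping.keys r \<subseteq> S \<Longrightarrow> 0 \<le> moment_functional z (r * r)"
    and diag: "\<And>\<alpha>. \<alpha> \<in> S \<Longrightarrow> z (\<alpha> + \<alpha>) \<le> K" and "\<alpha> \<in> S" "\<gamma> \<in> S"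
  shows "\<bar>z (\<alpha> + \<gamma>)\<bar> \<le> K"
proof -
  have "0 \<le> moment_functional z ((pmonom \<alpha> + pmonom \<gamma>) * (pmonom \<alpha> + pmonom \<gamma>))"
    using keys_add[of "pmonom \<alpha>" "pmonom \<gamma>"] assms(3,4) by (intro psd) auto
  moreover have "0 \<le> moment_functional z ((pmonom \<alpha> - pmonom \<gamma>) * (pmonom \<alpha> - pmonom \<gamma>))"
    using keys_diff[of "pmonom \<alpha>" "pmonom \<gamma>"] assms(3,4) by (intro psd) auto
  ultimately show ?thesis
    using diag[OF assms(3)] diag[OF assms(4)]
    by (simp add: algebra_simps pmonom_mult moment_functional_add moment_functional_diff
        numeral_eq_pconst moment_functional_pconst_mult)
qed

text \<open>The norm bound, localized at a linear monomial, trades a factor from [1, x] for the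
  constant \<open>C\<close>. An element of \<B> is such a factor times a linear monomial, whose own
  diagonal moment is at most \<open>C\<close>; this gives \<open>C * C\<close>.\<close>

lemma sparse_diagonal_bounded:
  assumes "admissible_data N P"
  obtains K where
    "\<And>z \<alpha>. z \<in> sparse_feasible N P \<Longrightarrow> \<alpha> \<in> set (mons_B (xdim P) N) \<Longrightarrow> z (\<alpha> + \<alpha>) \<le> K"
proof -
  obtain C where C: "C \<ge> 1"
    "\<And>z s. (\<And>h. h \<in> h_x P \<Longrightarrow> moment_functional z (h * s) = 0) \<Longrightarrow>
       (\<And>g. g \<in> g_ineq P \<Longrightarrow> 0 \<le> moment_functional z (g * s)) \<Longrightarrow> 0 \<le> moment_functional z s \<Longrightarrow>
       (\<Sum>i<xdim P. moment_functional z (pvar i * pvar i * s)) \<le> C * moment_functional z s"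
    using moment_functional_sum_squares_le[OF assms] by blast
  let ?n = "xdim P" and ?m = "xdim P + N"
  have "z (\<alpha> + \<alpha>) \<le> C * C" if z: "z \<in> sparse_feasible N P" and \<alpha>: "\<alpha> \<in> set (mons_B ?n N)" for z \<alpha>
  proof -
    note zf = z[unfolded sparse_feasible_iff]
    have nonneg: "0 \<le> z (\<gamma> + \<gamma>)" if "\<gamma> \<in> set (mons_B ?n N)" for \<gamma>
      using zf that by (metis keys_pmonom moment_functional_pmonom pmonom_mult empty_subsetI insert_subset)
    have nonneg1: "0 \<le> z (\<gamma> + \<gamma>)" if "\<gamma> \<in> expos_upto ?m 1" for \<gamma>
      using nonneg expos_upto_subset_mons_B(2)[of ?n N] that by blast
    \<comment> \<open>All summands in the localized norm bound are diagonal moments, hence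
      nonnegative, so the bound passes to each of them; the case \<open>\<delta> = 0\<close> uses
      \<open>C \<ge> 1\<close>.\<close>
    have step: "z ((\<delta> + \<gamma>) + (\<delta> + \<gamma>)) \<le> C * z (\<gamma> + \<gamma>)"
      if "\<delta> \<in> expos_upto ?n 1" "\<gamma> \<in> expos_upto ?m 1" for \<delta> \<gamma>
    proof -
      have "(\<Sum>i<?n. moment_functional z (pvar i * pvar i * (pmonom \<gamma> * pmonom \<gamma>)))
          \<le> C * moment_functional z (pmonom \<gamma> * pmonom \<gamma>)"
      proof (rule C(2))
        show "moment_functional z (h * (pmonom \<gamma> * pmonom \<gamma>)) = 0" if "h \<in> h_x P" for h
          using zf that \<open>\<gamma> \<in> _\<close> by blast
        show "0 \<le> moment_functional z (g * (pmonom \<gamma> * pmonom \<gamma>))" if "g \<in> g_ineq P" for g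
          using zf that \<open>\<gamma> \<in> _\<close> by simp
        show "0 \<le> moment_functional z (pmonom \<gamma> * pmonom \<gamma>)"
          using nonneg1[OF \<open>\<gamma> \<in> _\<close>] by (simp add: pmonom_mult)
      qed
      then have sum: "(\<Sum>i<?n. z ((evar i + \<gamma>) + (evar i + \<gamma>))) \<le> C * z (\<gamma> + \<gamma>)"
        by (simp add: pvar_def pmonom_mult add_ac)
      consider "\<delta> = 0" | i where "i < ?n" "\<delta> = evar i"
        using \<open>\<delta> \<in> expos_upto ?n 1\<close> unfolding expos_upto_1 by blast
      then show ?thesis
      proof cases
        case 1
        then show ?thesis
          using mult_right_mono[OF C(1) nonneg1[OF that(2)]] by simp
      next
        case (2 i)
        have "0 \<le> z ((evar j + \<gamma>) + (evar j + \<gamma>))" if "j < ?n" for j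
          using that \<open>\<gamma> \<in> _\<close> by (intro nonneg add_in_mons_B evar_in_expos_upto) auto
        then have "z ((evar i + \<gamma>) + (evar i + \<gamma>)) \<le> (\<Sum>i<?n. z ((evar i + \<gamma>) + (evar i + \<gamma>)))"
          using 2 by (intro member_le_sum[of i "{..<?n}" "\<lambda>i. z ((evar i + \<gamma>) + (evar i + \<gamma>))"]) auto
        with sum 2 show ?thesis by simp
      qed
    qed
    \<comment> \<open>For an exponent of [1, x] this is \<open>step\<close> with second exponent 0;
      for \<theta>_i the equation localized by the monomial 1 gives the value 1.\<close>
    have linear: "z (\<gamma> + \<gamma>) \<le> C" if \<gamma>: "\<gamma> \<in> expos_upto ?m 1" for \<gamma>
    proof (cases "\<gamma> \<in> expos_upto ?n 1")
      case True
      then show ?thesis using step[of \<gamma> 0] zf by simp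
    next
      case False
      then obtain i where i: "\<gamma> = evar (?n + i)" "i < N"
        using \<gamma> by (elim theta_exponentE)
      then have "1 - (theta P i)\<^sup>2 \<in> h_theta N P" by (auto simp: h_theta_def)
      then have "moment_functional z ((1 - (theta P i)\<^sup>2) * (pmonom 0 * pmonom 0)) = 0"
        using zf zero_in_expos_upto by blast
      then have "z (\<gamma> + \<gamma>) = 1"
        using zf i by (simp add: moment_functional_diff power2_eq_square theta_def pvar_def pmonom_mult)
      then show ?thesis using C by simp
    qed
    obtain \<delta> \<gamma> where "\<delta> \<in> expos_upto ?n 1" "\<gamma> \<in> expos_upto ?m 1" "\<alpha> = \<delta> + \<gamma>"
      using \<alpha> unfolding set_mons_B by blast
    moreover from this have "C * z (\<gamma> + \<gamma>) \<le> C * C"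
      using C(1) by (intro mult_left_mono linear) simp_all
    ultimately show ?thesis
      using step[of \<delta> \<gamma>] by simp
  qed
  then show ?thesis using that by blast
qed

lemma sparse_moments_bounded:
  assumes "admissible_data N P"
  obtains K where "\<And>z \<alpha>. z \<in> sparse_feasible N P \<Longrightarrow> \<alpha> \<in> expo_double (mons_B (xdim P) N) \<Longrightarrow> \<bar>z \<alpha>\<bar> \<le> K"
proof -
  obtain K where K: "\<And>z \<alpha>. z \<in> sparse_feasible N P \<Longrightarrow> \<alpha> \<in> set (mons_B (xdim P) N) \<Longrightarrow> z (\<alpha> + \<alpha>) \<le> K"
    using sparse_diagonal_bounded[OF assms] by blast
  have "\<bar>z \<alpha>\<bar> \<le> K" if z: "z \<in> sparse_feasible N P" and \<alpha>: "\<alpha> \<in> expo_double (mons_B (xdim P) N)" for z \<alpha>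
  proof -
    obtain \<gamma> \<delta> where "\<alpha> = \<gamma> + \<delta>" "\<gamma> \<in> set (mons_B (xdim P) N)" "\<delta> \<in> set (mons_B (xdim P) N)"
      using \<alpha> by (auto simp: expo_double_def)
    then show ?thesis
      using abs_moment_le[of "set (mons_B (xdim P) N)" z K \<gamma> \<delta>] K[OF z] z[unfolded sparse_feasible_iff]
      by blast
  qed
  then show ?thesis using that by blast
qed

text \<open>On \<B> the diagonal bound is inherited by restriction. Otherwise some factor is a
  \<theta>_i, and the dense relaxation, which localizes 1 - \<theta>_i^2 by all linear monomials,
  allows \<theta>_i^2 to be cancelled. What remains is linear and hence in \<B>.\<close>

lemma dense_moments_bounded:
  assumes "admissible_data N P"
  obtains K where "\<And>z \<alpha>. z \<in> dense_feasible N P \<Longrightarrow> \<alpha> \<in> expos_upto (xdim P + N) 4 \<Longrightarrow> \<bar>z \<alpha>\<bar> \<le> K"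
proof -
  let ?n = "xdim P" and ?m = "xdim P + N"
  obtain K where K: "\<And>z \<alpha>. z \<in> sparse_feasible N P \<Longrightarrow> \<alpha> \<in> set (mons_B ?n N) \<Longrightarrow> z (\<alpha> + \<alpha>) \<le> K"
    using sparse_diagonal_bounded[OF assms] by blast
  have "\<bar>z \<alpha>\<bar> \<le> K" if z: "z \<in> dense_feasible N P" and \<alpha>: "\<alpha> \<in> expos_upto ?m 4" for z \<alpha>
  proof -
    note zf = z[unfolded dense_feasible_iff]
    have B: "z (\<gamma> + \<gamma>) \<le> K" if "\<gamma> \<in> set (mons_B ?n N)" for \<gamma>
      using K[OF dense_restricts_to_sparse[OF z] that] add_in_expo_double[OF that that] by simp
    have diag: "z (\<gamma> + \<gamma>) \<le> K" if \<gamma>2: "\<gamma> \<in> expos_upto ?m 2" for \<gamma>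
    proof -
      obtain \<delta> \<epsilon> where \<gamma>: "\<gamma> = \<delta> + \<epsilon>" "\<delta> \<in> expos_upto ?m 1" "\<epsilon> \<in> expos_upto ?m 1"
        using \<gamma>2 unfolding expos_upto_2 by blast
      show ?thesis
      proof (cases "\<delta> \<in> expos_upto ?n 1")
        case True
        then show ?thesis using \<gamma>(1) B[OF add_in_mons_B[OF True \<gamma>(3)]] by simp
      next
        case False
        then obtain i where i: "\<delta> = evar (?n + i)" "i < N"
          using \<gamma>(2) by (elim theta_exponentE)
        then have "1 - (theta P i)\<^sup>2 \<in> h_theta N P" by (auto simp: h_theta_def)
        then have "moment_functional z ((1 - (theta P i)\<^sup>2) * (pmonom \<epsilon> * pmonom \<epsilon>)) = 0"
          using zf \<gamma>(3) by blast
        then have "z (\<gamma> + \<gamma>) = z (\<epsilon> + \<epsilon>)"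
          using i \<gamma>(1) by (simp add: left_diff_distrib moment_functional_diff power2_eq_square
              theta_def pvar_def pmonom_mult add_ac)
        also have "\<dots> \<le> K"
          using \<gamma>(3) expos_upto_subset_mons_B(2)[of ?n N] by (intro B) auto
        finally show ?thesis .
      qed
    qed
    have "\<alpha> \<in> expos_upto ?m (2 + 2)" using \<alpha> by simp
    then obtain \<gamma> \<delta> where "\<alpha> = \<gamma> + \<delta>" "\<gamma> \<in> expos_upto ?m 2" "\<delta> \<in> expos_upto ?m 2"
      by (rule expos_upto_addE)
    then show ?thesis
      using abs_moment_le[of "expos_upto ?m 2" z K \<gamma> \<delta>] diag zf by blast
  qed
  then show ?thesis using that by blast
qed

section \<open>Existence of optimal solutions\<close>

text \<open>Tychonoff's theorem, for functions with the topology of pointwise convergence.\<close>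

lemma compact_coordinatewise:
  fixes S :: "'a \<Rightarrow> 'b::topological_space set"
  assumes "\<And>i. compact (S i)"
  shows "compact {f. \<forall>i. f i \<in> S i}"
proof -
  have "compactin (product_topology (\<lambda>i. euclidean) UNIV) (PiE UNIV S)"
    unfolding compactin_PiE using assms by simp
  then show ?thesis
    by (simp add: euclidean_product_topology PiE_UNIV_domain Pi_def)
qed

lemma continuous_moment_functional: "continuous_on UNIV (\<lambda>z. moment_functional z q)"
  unfolding moment_functional_def by (intro continuous_intros continuous_on_product_coordinates)

lemma continuous_on_vec_index:
  "continuous_on UNIV (\<lambda>f :: nat \<Rightarrow> real. vec m f $ i)"
proof (cases "i < m")
  case False
  \<comment> \<open>Beyond the dimension, \<open>$\<close> returns a default value that does not
    depend on \<open>f\<close>, so the map is constant.\<close>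
  then have "vec m f $ i = undef_vec (i - m)" for f :: "nat \<Rightarrow> real"
    by transfer (simp add: mk_vec_def)
  then show ?thesis by simp
qed simp

lemma continuous_peval_vec: "continuous_on UNIV (\<lambda>f. peval q (vec m f))"
  unfolding peval_def expo_eval_def by (intro continuous_intros continuous_on_vec_index)

lemma ex_arg_min:
  fixes f :: "'a::topological_space \<Rightarrow> real"
  assumes "compact S" "S \<noteq> {}" "continuous_on UNIV f"
  shows "\<exists>x. is_arg_min f (\<lambda>x. x \<in> S) x"
  using continuous_attains_inf[OF assms(1,2) continuous_on_subset[OF assms(3)]]
  by (auto simp: is_arg_min_def not_less)

text \<open>Bounded moments place the set in a product of compact sets, and each constraint is a
  closed condition since it tests one fixed polynomial, which involves finitely many
  coordinates.\<close>

lemma compact_sparse_feasible: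
  assumes "admissible_data N P"
  shows "compact (sparse_feasible N P)"
proof -
  let ?I = "expo_double (mons_B (xdim P) N)"
  obtain K where K: "\<And>z \<alpha>. z \<in> sparse_feasible N P \<Longrightarrow> \<alpha> \<in> ?I \<Longrightarrow> \<bar>z \<alpha>\<bar> \<le> K"
    using sparse_moments_bounded[OF assms] by blast
  \<comment> \<open>Extensionality freezes the coordinates outside \<open>?I\<close> at
    \<open>undefined\<close>, a one-point factor.\<close>
  let ?box = "{z. \<forall>\<alpha>. z \<alpha> \<in> (if \<alpha> \<in> ?I then {-K..K} else {undefined})}"
  have "closed {z. z 0 = 1 \<and>
     (\<forall>r. Poly_Mapping.keys r \<subseteq> set (mons_B (xdim P) N) \<longrightarrow> 0 \<le> moment_functional z (r * r)) \<and>
     (\<forall>h\<in>h_x P. \<forall>\<alpha>\<in>expos_upto (xdim P + N) 1. \<forall>\<gamma>\<in>expos_upto (xdim P + N) 1.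
        moment_functional z (h * (pmonom \<alpha> * pmonom \<gamma>)) = 0) \<and>
     (\<forall>h\<in>h_theta N P. \<forall>\<alpha>\<in>expos_upto (xdim P) 1. \<forall>\<gamma>\<in>expos_upto (xdim P) 1.
        moment_functional z (h * (pmonom \<alpha> * pmonom \<gamma>)) = 0) \<and>
     (\<forall>g\<in>g_ineq P. \<forall>r. Poly_Mapping.keys r \<subseteq> expos_upto (xdim P + N) 1 \<longrightarrow>
        0 \<le> moment_functional z (g * (r * r)))}" (is "closed ?T")
    unfolding Ball_def
    by (intro closed_Collect_conj closed_Collect_all closed_Collect_imp open_Collect_const
        closed_Collect_le closed_Collect_eq continuous_moment_functional continuous_on_const
        continuous_on_product_coordinates)
  moreover have "compact ?box" by (rule compact_coordinatewise) simp
  moreover have "sparse_feasible N P = ?box \<inter> ?T"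
    using K by (auto simp: sparse_feasible_iff extensional_def abs_le_iff minus_le_iff
        split: if_splits)
  ultimately show ?thesis by (simp add: compact_Int_closed)
qed

lemma compact_dense_feasible:
  assumes "admissible_data N P"
  shows "compact (dense_feasible N P)"
proof -
  let ?I = "expos_upto (xdim P + N) 4"
  obtain K where K: "\<And>z \<alpha>. z \<in> dense_feasible N P \<Longrightarrow> \<alpha> \<in> ?I \<Longrightarrow> \<bar>z \<alpha>\<bar> \<le> K"
    using dense_moments_bounded[OF assms] by blast
  let ?box = "{z. \<forall>\<alpha>. z \<alpha> \<in> (if \<alpha> \<in> ?I then {-K..K} else {undefined})}"
  have "closed {z. z 0 = 1 \<and>
     (\<forall>r. Poly_Mapping.keys r \<subseteq> expos_upto (xdim P + N) 2 \<longrightarrow> 0 \<le> moment_functional z (r * r)) \<and>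
     (\<forall>h\<in>h_x P \<union> h_theta N P. \<forall>\<alpha>\<in>expos_upto (xdim P + N) 1. \<forall>\<gamma>\<in>expos_upto (xdim P + N) 1.
        moment_functional z (h * (pmonom \<alpha> * pmonom \<gamma>)) = 0) \<and>
     (\<forall>g\<in>g_ineq P. \<forall>r. Poly_Mapping.keys r \<subseteq> expos_upto (xdim P + N) 1 \<longrightarrow>
        0 \<le> moment_functional z (g * (r * r)))}" (is "closed ?T")
    unfolding Ball_def
    by (intro closed_Collect_conj closed_Collect_all closed_Collect_imp open_Collect_const
        closed_Collect_le closed_Collect_eq continuous_moment_functional continuous_on_const
        continuous_on_product_coordinates)
  moreover have "compact ?box" by (rule compact_coordinatewise) simp
  moreover have "dense_feasible N P = ?box \<inter> ?T"
    using K by (auto simp: dense_feasible_iff extensional_def abs_le_iff minus_le_iff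
        split: if_splits)
  ultimately show ?thesis by (simp add: compact_Int_closed)
qed

lemma ex_sparse_optimal: "admissible_data N P \<Longrightarrow> \<exists>z. sparse_optimal N \<beta> c P z"
  unfolding sparse_optimal_def
  by (rule ex_arg_min[OF compact_sparse_feasible _ continuous_moment_functional])
    (use pop_feasible_gives_sparse pop_feasible_nonempty[of N P] in blast)+

lemma ex_dense_optimal: "admissible_data N P \<Longrightarrow> \<exists>z. dense_optimal N \<beta> c P z"
  unfolding dense_optimal_def
  by (rule ex_arg_min[OF compact_dense_feasible _ continuous_moment_functional])
    (use pop_feasible_gives_dense pop_feasible_nonempty[of N P] in blast)+

text \<open>The coordinates of \<open>p\<close> are the degree-one moments of its lift, so the bound
  on sparse moments applies.\<close>

lemma pop_feasible_bounded:
  assumes "admissible_data N P"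
  obtains K where "\<And>p i. p \<in> pop_feasible N P \<Longrightarrow> i < xdim P + N \<Longrightarrow> \<bar>p $ i\<bar> \<le> K"
proof -
  obtain K where K: "\<And>z \<alpha>. z \<in> sparse_feasible N P \<Longrightarrow> \<alpha> \<in> expo_double (mons_B (xdim P) N) \<Longrightarrow> \<bar>z \<alpha>\<bar> \<le> K"
    using sparse_moments_bounded[OF assms] by blast
  have "\<bar>p $ i\<bar> \<le> K" if "p \<in> pop_feasible N P" "i < xdim P + N" for p i
  proof -
    show ?thesis
      using K[OF pop_feasible_gives_sparse[OF that(1)] evar_in_double[OF that(2)]]
        evar_in_double[OF that(2)] by simp
  qed
  then show ?thesis using that by blast
qed

text \<open>Compactness is argued for coordinate functions \<open>f\<close> representing the point
  \<open>vec ?m f\<close>; freezing the coordinates from \<open>?m\<close> on at 0 makes the box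
  compact.\<close>

lemma ex_pop_minimizer:
  assumes "admissible_data N P"
  shows "\<exists>p. pop_minimizer N \<beta> c P p"
proof -
  let ?m = "xdim P + N"
  obtain K where K: "\<And>p i. p \<in> pop_feasible N P \<Longrightarrow> i < ?m \<Longrightarrow> \<bar>p $ i\<bar> \<le> K"
    using pop_feasible_bounded[OF assms] by blast
  let ?box = "{f. \<forall>i. f i \<in> (if i < ?m then {-K..K} else {0})}"
  let ?S = "?box \<inter> {f. vec ?m f \<in> pop_feasible N P}"
  have "closed {f. vec ?m f \<in> pop_feasible N P}"
    unfolding pop_feasible_def mem_Collect_eq Ball_def
    by (intro closed_Collect_conj closed_Collect_all closed_Collect_imp open_Collect_const
        closed_Collect_le closed_Collect_eq continuous_peval_vec continuous_on_const) simp
  moreover have "compact ?box" by (rule compact_coordinatewise) simp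
  ultimately have "compact ?S" by (rule compact_Int_closed[rotated])
  \<comment> \<open>Every feasible point has a representative, so a minimum over \<open>?S\<close>
    is a minimum over the feasible set.\<close>
  have rep: "\<exists>f\<in>?S. vec ?m f = p" if p: "p \<in> pop_feasible N P" for p
  proof
    show eq: "vec ?m (\<lambda>i. if i < ?m then p $ i else 0) = p"
      using p by (intro eq_vecI) (auto simp: pop_feasible_def)
    show "(\<lambda>i. if i < ?m then p $ i else 0) \<in> ?S"
      using p K[OF p] by (auto simp: eq abs_le_iff minus_le_iff)
  qed
  then have "?S \<noteq> {}" using pop_feasible_nonempty[of N P] by blast
  from ex_arg_min[OF \<open>compact ?S\<close> this continuous_peval_vec]
  obtain f where f: "is_arg_min (\<lambda>f. peval (objective N \<beta> c P) (vec ?m f)) (\<lambda>f. f \<in> ?S) f"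
    by blast
  have "\<not> peval (objective N \<beta> c P) p < peval (objective N \<beta> c P) (vec ?m f)"
    if p: "p \<in> pop_feasible N P" for p
  proof -
    obtain f' where "f' \<in> ?S" "vec ?m f' = p" using rep[OF p] by (rule bexE)
    then show ?thesis using f by (auto simp: is_arg_min_def)
  qed
  moreover have "vec ?m f \<in> pop_feasible N P"
    using f by (simp add: is_arg_min_def)
  ultimately have "pop_minimizer N \<beta> c P (vec ?m f)"
    by (auto simp: pop_minimizer_def is_arg_min_def)
  then show ?thesis ..
qed

section \<open>Rank-one moment matrices\<close>

text \<open>Otherwise the 2 x 2 minor of rows 0, \<open>k\<close> and columns 0, \<open>j\<close> is
  nonzero, columns 0 and \<open>j\<close> are independent, and the rank is at least 2.\<close>

lemma rank_one_entries:
  fixes A :: "real mat"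
  assumes A: "A \<in> carrier_mat n nc" and rank: "vec_space.rank n A = 1" and "A $$ (0, 0) = 1"
    and "0 < n" "k < n" "j < nc"
  shows "A $$ (k, j) = A $$ (k, 0) * A $$ (0, j)"
proof (rule ccontr)
  interpret vec_space "TYPE(real)" n .
  assume neq: "A $$ (k, j) \<noteq> A $$ (k, 0) * A $$ (0, j)"
  have "0 < nc" using \<open>j < nc\<close> by simp
  define a b where "a = col A 0" and "b = col A j"
  have entries: "a $ i = A $$ (i, 0)" "b $ i = A $$ (i, j)" if "i < n" for i
    using that A \<open>j < nc\<close> \<open>0 < nc\<close> by (auto simp: a_def b_def)
  have ab: "a \<in> carrier_vec n" "b \<in> carrier_vec n"
    using A by (auto simp: a_def b_def carrier_vecI)
  \<comment> \<open>Independence and cardinality concern the set \<open>{a, b}\<close>, so the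
    columns must differ: equal ones would give \<open>A $$ (0, j) = 1\<close> and satisfy the
    claimed identity.\<close>
  have "a \<noteq> b"
    using neq entries[OF \<open>0 < n\<close>] entries[OF \<open>k < n\<close>] assms(3) by force
  have "lin_indpt {a, b}"
  proof (rule finite_lin_indpt2)
    fix f assume "lincomb f {a, b} = 0\<^sub>v n"
    then have eq: "f a * a $ i + f b * b $ i = 0" if "i < n" for i
      using lincomb_index[OF that, of "{a, b}" f] ab \<open>a \<noteq> b\<close> that by simp
    \<comment> \<open>Row 0 determines \<open>f a\<close>; substituted into row \<open>k\<close>, it
      leaves \<open>f b\<close> times the minor.\<close>
    have a0: "f a = - f b * A $$ (0, j)"
      using eq[OF \<open>0 < n\<close>] entries[OF \<open>0 < n\<close>] assms(3) by simp
    then have "f b * (A $$ (k, j) - A $$ (k, 0) * A $$ (0, j)) = 0"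
      using eq[OF \<open>k < n\<close>] entries[OF \<open>k < n\<close>] by (simp add: algebra_simps)
    with neq a0 show "\<forall>v\<in>{a, b}. f v = 0" by simp
  qed (use ab in auto)
  moreover have "{a, b} \<subseteq> set (cols A)"
    using A \<open>j < nc\<close> \<open>0 < nc\<close> by (auto simp: a_def b_def cols_def)
  ultimately have "card {a, b} \<le> rank A"
    using rank_ge_card_indpt[OF A] by blast
  with rank \<open>a \<noteq> b\<close> show False by simp
qed

text \<open>The list starts with the monomial 1, so the corner entry is \<open>z 0 = 1\<close> and
  row and column 0 contain the moments themselves.\<close>

lemma rank_one_moments_multiplicative:
  assumes "mat_rank (moment_mat (0 # S) z) = 1" "z 0 = 1" "\<alpha> \<in> set (0 # S)" "\<gamma> \<in> set (0 # S)"
  shows "z (\<alpha> + \<gamma>) = z \<alpha> * z \<gamma>"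
proof -
  let ?S = "0 # S" and ?M = "moment_mat (0 # S) z"
  have entry: "?M $$ (i, j) = z (?S ! i + ?S ! j)" if "i < length ?S" "j < length ?S" for i j
    using that by (simp add: localizing_mat_def pmonom_mult del: length_Cons)
  obtain i j where ij: "i < length ?S" "\<alpha> = ?S ! i" "j < length ?S" "\<gamma> = ?S ! j"
    using assms(3,4) unfolding in_set_conv_nth by blast
  have "?M $$ (i, j) = ?M $$ (i, 0) * ?M $$ (0, j)"
    using ij assms(1,2) entry[of 0 0]
    by (intro rank_one_entries[OF localizing_mat_carrier(1)]) (simp_all add: mat_rank_def)
  then show ?thesis
    using ij entry[of i j] entry[of i 0] entry[of 0 j] by simp
qed

text \<open>Agreement with evaluation at \<open>p\<close> spreads from degree one to \<B>, by
  splitting into two linear monomials that both lie in \<B>, and then to 2\<B>. Feasibility follows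
  by testing the localized constraints with the polynomial 1.\<close>

lemma rank_one_sparse_moments:
  assumes z: "z \<in> sparse_feasible N P" and rank: "mat_rank (sparse_moment_mat N P z) = 1"
  shows "\<exists>p\<in>pop_feasible N P. \<forall>\<alpha>\<in>expo_double (mons_B (xdim P) N). z \<alpha> = expo_eval p \<alpha>"
proof -
  let ?B = "mons_B (xdim P) N" and ?m = "xdim P + N"
  note zf = z[unfolded sparse_feasible_iff]
  define p where "p = vec ?m (\<lambda>i. z (evar i))"
  obtain S where S: "?B = 0 # S" by (simp add: mons_B_def)
  have mult: "z (\<alpha> + \<gamma>) = z \<alpha> * z \<gamma>" if "\<alpha> \<in> set ?B" "\<gamma> \<in> set ?B" for \<alpha> \<gamma>
    using rank_one_moments_multiplicative[of S z \<alpha> \<gamma>] rank zf that unfolding S by simp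
  have linear: "z \<alpha> = expo_eval p \<alpha>" if "\<alpha> \<in> expos_upto ?m 1" for \<alpha>
    using that zf unfolding expos_upto_1 by (auto simp: p_def)
  have quadratic: "z \<alpha> = expo_eval p \<alpha>" if \<alpha>: "\<alpha> \<in> set ?B" for \<alpha>
  proof -
    obtain \<gamma> \<delta> where \<gamma>\<delta>: "\<alpha> = \<gamma> + \<delta>" "\<gamma> \<in> expos_upto ?m 1" "\<delta> \<in> expos_upto ?m 1"
      using subsetD[OF mons_B_subset_expos_upto \<alpha>] unfolding expos_upto_2 by blast
    then have "\<gamma> \<in> set ?B" "\<delta> \<in> set ?B"
      using expos_upto_subset_mons_B(2)[of "xdim P" N] by blast+
    then show ?thesis
      using \<gamma>\<delta> by (simp add: mult linear expo_eval_add del: One_nat_def)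
  qed
  have double: "z \<alpha> = expo_eval p \<alpha>" if "\<alpha> \<in> expo_double ?B" for \<alpha>
    using that by (auto simp: expo_double_def mult quadratic expo_eval_add)
  have eval: "moment_functional z q = peval q p" if "Poly_Mapping.keys q \<subseteq> expo_double ?B" for q
    unfolding peval_eq_moment_functional using that double by (intro moment_functional_cong) blast
  \<comment> \<open>Padding \<open>q\<close> with \<open>1 * 1\<close> gives it the shape quadratic
    times linear times linear.\<close>
  have constr: "moment_functional z q = peval q p" if "q \<in> polys_upto (xdim P) 2" for q
    using keys_quadratic_times_linear[OF that one_in_polys_upto one_in_polys_upto] by (simp add: eval)
  have "p \<in> pop_feasible N P"
    unfolding pop_feasible_def
  proof (intro CollectI conjI ballI)
    show "p \<in> carrier_vec ?m" by (simp add: p_def)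
    show "peval h p = 0" if "h \<in> h_x P \<union> h_theta N P" for h
    proof (cases "h \<in> h_x P")
      case True
      then have "moment_functional z (h * (pmonom 0 * pmonom 0)) = 0"
        using zf zero_in_expos_upto by blast
      then show ?thesis
        using True constr[of h] h_x_subset_polys_upto by auto
    next
      case False
      then have h: "h \<in> h_theta N P" using that by blast
      then have "moment_functional z (h * (pmonom 0 * pmonom 0)) = 0"
        using zf zero_in_expos_upto by blast
      then show ?thesis
        using eval[OF keys_theta_localizer[OF h zero_in_expos_upto zero_in_expos_upto]] by simp
    qed
    show "0 \<le> peval g p" if "g \<in> g_ineq P" for g
    proof -
      have "Poly_Mapping.keys (1 :: rpoly) \<subseteq> expos_upto ?m 1" by simp
      then have "0 \<le> moment_functional z (g * (1 * 1))"
        using zf that by blast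
      then show ?thesis
        using constr[OF subsetD[OF g_ineq_subset_polys_upto that]] by simp
    qed
  qed (rule peval_g_ineq_le_1)
  with double show ?thesis by blast
qed

section \<open>Comparison of optimal values and the optimality certificate\<close>

lemma Inf_eq_arg_min:
  fixes f :: "'a \<Rightarrow> real"
  assumes "is_arg_min f (\<lambda>x. x \<in> S) x"
  shows "(INF y\<in>S. f y) = f x"
  using assms by (intro cInf_eq_minimum) (auto simp: is_arg_min_def not_less)

lemma is_arg_min_le: "is_arg_min f (\<lambda>x. x \<in> S) x \<Longrightarrow> y \<in> S \<Longrightarrow> f x \<le> (f y :: real)"
  by (auto simp: is_arg_min_def not_less)

text \<open>A dense optimum restricts to a sparse feasible vector with the same objective, as the
  exponents of the objective lie in 2\<B>.\<close>

lemma sparse_value_le_dense_value: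
  assumes "admissible_data N P"
  shows "sparse_value N \<beta> c P \<le> dense_value N \<beta> c P"
proof -
  obtain y z where y: "sparse_optimal N \<beta> c P y" and z: "dense_optimal N \<beta> c P z"
    using ex_sparse_optimal[OF assms] ex_dense_optimal[OF assms] by blast
  then have "z \<in> dense_feasible N P" by (simp add: dense_optimal_def is_arg_min_def)
  from is_arg_min_le[OF y[unfolded sparse_optimal_def] dense_restricts_to_sparse[OF this]]
  show ?thesis
    using Inf_eq_arg_min[OF y[unfolded sparse_optimal_def]]
      Inf_eq_arg_min[OF z[unfolded dense_optimal_def]]
    by (simp add: sparse_value_def dense_value_def moment_functional_restrict keys_objective[OF assms])
qed

text \<open>A POP minimizer lifts to a dense feasible vector whose objective is its POP
  value.\<close>

lemma dense_value_le_pop_value: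
  assumes "admissible_data N P"
  shows "dense_value N \<beta> c P \<le> pop_value N \<beta> c P"
proof -
  obtain p z where p: "pop_minimizer N \<beta> c P p" and z: "dense_optimal N \<beta> c P z"
    using ex_pop_minimizer[OF assms] ex_dense_optimal[OF assms] by blast
  then have "p \<in> pop_feasible N P" by (simp add: pop_minimizer_def is_arg_min_def)
  from is_arg_min_le[OF z[unfolded dense_optimal_def] pop_feasible_gives_dense[OF this]]
  show ?thesis
    using Inf_eq_arg_min[OF p[unfolded pop_minimizer_def]]
      Inf_eq_arg_min[OF z[unfolded dense_optimal_def]]
      order.trans[OF keys_objective[OF assms] expo_double_mons_B_subset]
    by (simp add: pop_value_def dense_value_def moment_functional_restrict peval_eq_moment_functional)
qed

text \<open>The point \<open>p\<close> attains the lower bound, since every feasible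
  \<open>q\<close> lifts to a sparse feasible vector of value f(q). A second minimizer would lift to
  a second optimal vector, so uniqueness of \<open>z\<close> carries over to
  \<open>p\<close>.\<close>

lemma sparse_optimality_certificate:
  assumes adm: "admissible_data N P" and z: "sparse_optimal N \<beta> c P z"
    and rank: "mat_rank (sparse_moment_mat N P z) = 1"
  shows "\<exists>p. pop_minimizer N \<beta> c P p \<and>
     moment_subvec (mons_B (xdim P) N) z = mon_vec (mons_B (xdim P) N) p \<and>
     ((\<forall>z'. sparse_optimal N \<beta> c P z' \<longrightarrow> z' = z) \<longrightarrow> (\<forall>q. pop_minimizer N \<beta> c P q \<longrightarrow> q = p))"
proof -
  let ?B = "mons_B (xdim P) N" and ?f = "objective N \<beta> c P"
  have zf: "z \<in> sparse_feasible N P" using z by (simp add: sparse_optimal_def is_arg_min_def)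
  obtain p where p: "p \<in> pop_feasible N P" and zp: "\<And>\<alpha>. \<alpha> \<in> expo_double ?B \<Longrightarrow> z \<alpha> = expo_eval p \<alpha>"
    using rank_one_sparse_moments[OF zf rank] by blast
  have value_z: "moment_functional z ?f = peval ?f p"
    unfolding peval_eq_moment_functional
    using keys_objective[OF adm] zp by (intro moment_functional_cong) blast
  have lift: "moment_functional (restrict (expo_eval q) (expo_double ?B)) ?f = peval ?f q" for q
    by (simp add: moment_functional_restrict keys_objective[OF adm] peval_eq_moment_functional)
  have "peval ?f p \<le> peval ?f q" if "q \<in> pop_feasible N P" for q
    using is_arg_min_le[OF z[unfolded sparse_optimal_def] pop_feasible_gives_sparse[OF that]]
    by (simp add: value_z lift)
  then have min: "pop_minimizer N \<beta> c P p"
    using p by (auto simp: pop_minimizer_def is_arg_min_def not_less)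
  have "moment_subvec ?B z = mon_vec ?B p"
    by (simp add: moment_subvec_def mon_vec_def zp subsetD[OF mons_B_subset_double] cong: map_cong)
  moreover have "q = p"
    if unique: "\<And>z'. sparse_optimal N \<beta> c P z' \<Longrightarrow> z' = z" and q: "pop_minimizer N \<beta> c P q" for q
  proof -
    let ?y = "restrict (expo_eval q) (expo_double ?B)"
    have qf: "q \<in> pop_feasible N P" using q by (simp add: pop_minimizer_def is_arg_min_def)
    \<comment> \<open>Both \<open>p\<close> and \<open>q\<close> minimize f, and the value at
      \<open>p\<close> is that of \<open>z\<close>; hence the lift of \<open>q\<close> is optimal as
      well.\<close>
    have "moment_functional ?y ?f \<le> moment_functional z ?f"
      using is_arg_min_le[OF q[unfolded pop_minimizer_def] p] by (simp add: value_z lift)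
    then have "sparse_optimal N \<beta> c P ?y"
      using z pop_feasible_gives_sparse[OF qf]
      by (fastforce simp: sparse_optimal_def is_arg_min_def)
    then have "?y = z" by (rule unique)
    \<comment> \<open>Coordinates are recovered as degree-one moments.\<close>
    have "q $ i = p $ i" if "i < xdim P + N" for i
      using fun_cong[OF \<open>?y = z\<close>, of "evar i"] evar_in_double[OF that] zp[of "evar i"] by simp
    then show ?thesis
      using p qf by (intro eq_vecI) (auto simp: pop_feasible_def)
  qed
  ultimately show ?thesis using min by blast
qed

text \<open>Existence of minimizers makes each \<open>INF\<close> a true minimum. "The optimal
  solution" enters (a) as a uniqueness premise on \<open>z\<close>: once the relaxation is tight,
  each POP minimizer lifts to an optimal solution of its own.\<close>

theorem theorem7:
  fixes N :: nat and \<beta> :: "nat \<Rightarrow> real" and c :: real and P :: problem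
  assumes "N \<ge> 1" and "c > 0" and "\<And>i. i < N \<Longrightarrow> \<beta> i > 0" and "admissible_data N P"
  shows
    "(\<exists>p. pop_minimizer N \<beta> c P p) \<and>
     (\<exists>z. dense_optimal N \<beta> c P z) \<and>
     (\<exists>z. sparse_optimal N \<beta> c P z) \<and>
     sparse_value N \<beta> c P \<le> dense_value N \<beta> c P \<and>
     dense_value N \<beta> c P \<le> pop_value N \<beta> c P \<and>
     (\<forall>z. sparse_optimal N \<beta> c P z \<and> mat_rank (sparse_moment_mat N P z) = 1 \<longrightarrow>
        (\<exists>p. pop_minimizer N \<beta> c P p \<and>
             moment_subvec (mons_B (xdim P) N) z = mon_vec (mons_B (xdim P) N) p \<and>
             ((\<forall>z'. sparse_optimal N \<beta> c P z' \<longrightarrow> z' = z) \<longrightarrow>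
              (\<forall>q. pop_minimizer N \<beta> c P q \<longrightarrow> q = p)))) \<and>
     (\<forall>z p. sparse_optimal N \<beta> c P z \<and> mat_rank (sparse_moment_mat N P z) > 1 \<and>
            rounded_estimate N P z p \<longrightarrow>
        p \<in> pop_feasible N P \<and>
        sparse_value N \<beta> c P \<le> pop_value N \<beta> c P \<and>
        pop_value N \<beta> c P \<le> peval (objective N \<beta> c P) p)"
proof -
  have val: "sparse_value N \<beta> c P \<le> pop_value N \<beta> c P"
    using sparse_value_le_dense_value[OF assms(4)] dense_value_le_pop_value[OF assms(4)]
    by (rule order.trans)
  \<comment> \<open>Projection returns a feasible point, and its value bounds the attained minimum
    from above.\<close>
  have round: "p \<in> pop_feasible N P \<and> pop_value N \<beta> c P \<le> peval (objective N \<beta> c P) p"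
    if "rounded_estimate N P z p" for z p
  proof -
    have p: "p \<in> pop_feasible N P"
      using that by (auto simp: rounded_estimate_def is_arg_min_def Let_def)
    obtain q where "pop_minimizer N \<beta> c P q"
      using ex_pop_minimizer[OF assms(4)] by blast
    then have "pop_value N \<beta> c P \<le> peval (objective N \<beta> c P) p"
      unfolding pop_minimizer_def pop_value_def
      using p by (simp add: Inf_eq_arg_min is_arg_min_le)
    with p show ?thesis by blast
  qed
  show ?thesis
    using ex_pop_minimizer[OF assms(4)] ex_dense_optimal[OF assms(4)] ex_sparse_optimal[OF assms(4)]
      sparse_value_le_dense_value[OF assms(4)] dense_value_le_pop_value[OF assms(4)]
      sparse_optimality_certificate[OF assms(4)] val round
    by blast
qed

end
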